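(* Let $\mathcal{C}:[u]\to 2^{[q]}$ be a $k$-superimposed code of length $q=O(\mathrm{poly}(K\log u))$ that can be decoded (i.e., for $Y\subseteq[q]$, one can compute $X$ with $|X|\le k$ and $\mathcal{C}(X)=Y$, or decide that none exists) in time $O(\mathrm{poly}(k\log u))$. Let $\mathcal{F}_1,\ldots,\mathcal{F}_c$ be nonempty set families over the universe $[u]$, each with at most $K$ sets, each of size at most $k$. There is a deterministic algorithm that, given only the set $S=\bigcup_{i=1}^{c}\mathcal{C}^{\otimes K}(\mathcal{F}_i)\subseteq[q]^K$, outputs exactly all solutions of the \textsc{Witness Superset} instance $\mathcal{F}_1,\ldots,\mathcal{F}_c$, in time $O\big((Kk\log u)^{O(K\cdot k)}\big)$.
   Context: A binary code of length $q$ on universe $[u]$ is a function $\mathcal{C}:[u]\to 2^{[q]}$; for $X\subseteq[u]$, $\mathcal{C}(X)=\bigcup_{x\in X}\mathcal{C}(x)$. $\mathcal{C}$ is $d$-superimposed if for every $X\subseteq[u]$ with $|X|\le d$ and every $y\notin X$, $\mathcal{C}(y)\not\subseteq\mathcal{C}(X)$. For a family $\mathcal{F}=\{F_1,\ldots,F_K\}$ of exactly $K$ sets (listed in arbitrary order), $\mathcal{C}^{\otimes K}(\mathcal{F})=\mathcal{C}(F_1)\times\cdots\times\mathcal{C}(F_K)\subseteq[q]^K$; if a nonempty family has fewer than $K$ sets, some of its sets are repeated to obtain a list of $K$ sets. \textsc{Witness Superset}: given set families $\mathcal{F}_1,\ldots,\mathcal{F}_c$ (each of at most $K$ sets of size at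 most $k$ over a universe $U$), find all $W\subseteq U$ such that: [cover] for every $i$ some member of $\mathcal{F}_i$ is a subset of $W$; [size] $|W|\le k$; [minimal] no proper subset of $W$ satisfies [cover]. *)

theory Defs
  imports Complex_Main "HOL-Computational_Algebra.Polynomial"
begin

section \<open>Computation model\<close>

text \<open>
  Running times refer to the WHILE language over binary trees (Jones, ``Computability and
  Complexity''): programs manipulate finitely many tree-valued variables, and every primitive
  operation (allocating a node, projecting, testing for the empty tree) costs one unit. Each of
  them is a constant-time pointer operation, so time agrees with Turing machine or RAM time up to
  polynomial factors. There is no primitive arithmetic and no primitive equality test; numbers
  are given in binary.
\<close>

datatype tree = Leaf | Node tree tree

fun left :: "tree \<Rightarrow> tree" where
  "left Leaf = Leaf"
| "left (Node l r) = l"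

fun right :: "tree \<Rightarrow> tree" where
  "right Leaf = Leaf"
| "right (Node l r) = r"

type_synonym store = "nat \<Rightarrow> tree"

datatype exp = Var nat | Empty | Pair exp exp | Left exp | Right exp

fun val :: "exp \<Rightarrow> store \<Rightarrow> tree" where
  "val (Var x) s = s x"
| "val Empty s = Leaf"
| "val (Pair e1 e2) s = Node (val e1 s) (val e2 s)"
| "val (Left e) s = left (val e s)"
| "val (Right e) s = right (val e s)"

fun cost :: "exp \<Rightarrow> nat" where
  "cost (Var x) = 1"
| "cost Empty = 1"
| "cost (Pair e1 e2) = 1 + cost e1 + cost e2"
| "cost (Left e) = 1 + cost e"
| "cost (Right e) = 1 + cost e"

text \<open>
  \<open>Call x c e\<close> runs the (syntactically nested, hence non-recursive) program \<open>c\<close> on the value of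
  \<open>e\<close> with its own local variables and assigns its result to \<open>x\<close>.
\<close>

datatype com =
    Skip
  | Assign nat exp
  | Seq com com
  | Cond exp com com
  | While exp com
  | Call nat com exp

text \<open>A program receives its input in variable 0 and leaves its output there.\<close>

definition init :: "tree \<Rightarrow> store" where
  "init inp = (\<lambda>_. Leaf)(0 := inp)"

text \<open>\<open>exec c s t s'\<close>: started in store \<open>s\<close>, \<open>c\<close> halts after exactly \<open>t\<close> steps in store \<open>s'\<close>.\<close>

inductive exec :: "com \<Rightarrow> store \<Rightarrow> nat \<Rightarrow> store \<Rightarrow> bool" where
  Skip: "exec Skip s 1 s"
| Assign: "exec (Assign x e) s (1 + cost e) (s(x := val e s))"
| Seq: "exec c1 s1 t1 s2 \<Longrightarrow> exec c2 s2 t2 s3 \<Longrightarrow> exec (Seq c1 c2) s1 (t1 + t2) s3"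
| CondTrue: "val e s \<noteq> Leaf \<Longrightarrow> exec c1 s t s' \<Longrightarrow> exec (Cond e c1 c2) s (1 + cost e + t) s'"
| CondFalse: "val e s = Leaf \<Longrightarrow> exec c2 s t s' \<Longrightarrow> exec (Cond e c1 c2) s (1 + cost e + t) s'"
| WhileFalse: "val e s = Leaf \<Longrightarrow> exec (While e c) s (1 + cost e) s"
| WhileTrue: "val e s1 \<noteq> Leaf \<Longrightarrow> exec c s1 t1 s2 \<Longrightarrow> exec (While e c) s2 t2 s3 \<Longrightarrow>
    exec (While e c) s1 (1 + cost e + t1 + t2) s3"
| Call: "exec c (init (val e s)) t s' \<Longrightarrow> exec (Call x c e) s (1 + cost e + t) (s(x := s' 0))"

definition runs :: "com \<Rightarrow> tree \<Rightarrow> nat \<Rightarrow> tree \<Rightarrow> bool" where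
  "runs c inp t out \<longleftrightarrow> (\<exists>s. exec c (init inp) t s \<and> s 0 = out)"

inductive_cases exec_elims:
  "exec Skip s t s'"
  "exec (Assign x e) s t s'"
  "exec (Seq c1 c2) s t s'"
  "exec (Cond e c1 c2) s t s'"
  "exec (While e c) s t s'"
  "exec (Call x c e) s t s'"

lemma exec_deterministic:
  "exec c s t s' \<Longrightarrow> exec c s t2 s2 \<Longrightarrow> t2 = t \<and> s2 = s'"
proof (induction arbitrary: t2 s2 rule: exec.induct)
  case (Skip s)
  then show ?case by (elim exec_elims) simp
next
  case (Assign x e s)
  then show ?case by (elim exec_elims) simp
next
  case (Seq c1 s1 t1 s2' c2 t2' s3)
  from Seq.prems show ?case
    by (rule exec_elims) (auto dest!: Seq.IH simp: Seq.hyps)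
next
  case (CondTrue e s c1 t s' c2)
  from CondTrue.prems show ?case
    by (rule exec_elims) (auto dest!: CondTrue.IH simp: CondTrue.hyps)
next
  case (CondFalse e s c2 t s' c1)
  from CondFalse.prems show ?case
    by (rule exec_elims) (auto dest!: CondFalse.IH simp: CondFalse.hyps)
next
  case (WhileFalse e s c)
  from WhileFalse.prems show ?case
    by (rule exec_elims) (auto simp: WhileFalse.hyps)
next
  case (WhileTrue e s1 c t1 s2' t2' s3)
  from WhileTrue.prems show ?case
    by (rule exec_elims) (auto dest!: WhileTrue.IH simp: WhileTrue.hyps)
next
  case (Call c e s t s' x)
  from Call.prems show ?case
    by (rule exec_elims) (auto dest!: Call.IH simp: Call.hyps)
qed

lemma runs_deterministic:
  "runs c inp t out \<Longrightarrow> runs c inp t' out' \<Longrightarrow> t' = t \<and> out' = out"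
  unfolding runs_def using exec_deterministic by blast


section \<open>Data representation\<close>

text \<open>Binary, least significant bit first.\<close>

fun enc_nat :: "nat \<Rightarrow> tree" where
  "enc_nat n = (if n = 0 then Leaf
     else Node (if odd n then Node Leaf Leaf else Leaf) (enc_nat (n div 2)))"

declare enc_nat.simps [simp del]

fun enc_list :: "('a \<Rightarrow> tree) \<Rightarrow> 'a list \<Rightarrow> tree" where
  "enc_list f [] = Leaf"
| "enc_list f (x # xs) = Node (f x) (enc_list f xs)"

fun enc_option :: "('a \<Rightarrow> tree) \<Rightarrow> 'a option \<Rightarrow> tree" where
  "enc_option f None = Leaf"
| "enc_option f (Some x) = Node Leaf (f x)"

text \<open>
  Programs receive and return a finite set as a list of its elements, without repetitions and in
  any order.
\<close>

definition lists_set :: "'a list \<Rightarrow> 'a set \<Rightarrow> bool" where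
  "lists_set xs A \<longleftrightarrow> distinct xs \<and> set xs = A"

definition lists_sets :: "'a list list \<Rightarrow> 'a set set \<Rightarrow> bool" where
  "lists_sets xss \<A> \<longleftrightarrow> (\<forall>xs\<in>set xss. distinct xs) \<and> lists_set (map set xss) \<A>"


section \<open>Superimposed codes\<close>

text \<open>The sets \<open>[u]\<close> and \<open>[q]\<close> are \<open>{1..u}\<close> and \<open>{1..q}\<close>.\<close>

definition binary_code :: "nat \<Rightarrow> nat \<Rightarrow> (nat \<Rightarrow> nat set) \<Rightarrow> bool" where
  "binary_code u q C \<longleftrightarrow> (\<forall>x\<in>{1..u}. C x \<subseteq> {1..q})"

definition code_of_set :: "(nat \<Rightarrow> nat set) \<Rightarrow> nat set \<Rightarrow> nat set" where
  "code_of_set C X = (\<Union>x\<in>X. C x)"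

definition superimposed :: "nat \<Rightarrow> nat \<Rightarrow> (nat \<Rightarrow> nat set) \<Rightarrow> bool" where
  "superimposed d u C \<longleftrightarrow>
     (\<forall>X. X \<subseteq> {1..u} \<and> card X \<le> d \<longrightarrow> (\<forall>y\<in>{1..u} - X. \<not> C y \<subseteq> code_of_set C X))"

text \<open>
  \<open>D\<close> decodes \<open>C\<close> within \<open>T\<close> steps. One program serves infinitely many codes; \<open>desc\<close> is the
  description telling it which one is meant (for instance its parameters).
\<close>

definition decodes :: "com \<Rightarrow> tree \<Rightarrow> nat \<Rightarrow> nat \<Rightarrow> nat \<Rightarrow> (nat \<Rightarrow> nat set) \<Rightarrow> real \<Rightarrow> bool" where
  "decodes D desc k u q C T \<longleftrightarrow>
     (\<forall>Y ys. Y \<subseteq> {1..q} \<and> lists_set ys Y \<longrightarrow>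
       (\<exists>t r. runs D (Node desc (enc_list enc_nat ys)) t (enc_option (enc_list enc_nat) r) \<and>
          real t \<le> T \<and>
          (case r of
             Some xs \<Rightarrow> \<exists>X. lists_set xs X \<and> X \<subseteq> {1..u} \<and> card X \<le> k \<and> code_of_set C X = Y
           | None \<Rightarrow> \<not> (\<exists>X. X \<subseteq> {1..u} \<and> card X \<le> k \<and> code_of_set C X = Y))))"

text \<open>The argument is a listing \<open>[F\<^sub>1, \<dots>, F\<^sub>K]\<close> of the family; \<open>K\<close>-tuples are lists of length \<open>K\<close>.\<close>

definition code_tensor :: "(nat \<Rightarrow> nat set) \<Rightarrow> nat set list \<Rightarrow> nat list set" where
  "code_tensor C Fs = listset (map (code_of_set C) Fs)"

definition listing :: "nat \<Rightarrow> 'a set \<Rightarrow> 'a list \<Rightarrow> bool" where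
  "listing K \<F> Fs \<longleftrightarrow> length Fs = K \<and> set Fs = \<F>"


section \<open>Witness Superset\<close>

definition witness_instance ::
    "nat \<Rightarrow> nat \<Rightarrow> nat \<Rightarrow> nat \<Rightarrow> (nat \<Rightarrow> nat set set) \<Rightarrow> bool" where
  "witness_instance K k u c \<F> \<longleftrightarrow>
     (\<forall>i\<in>{1..c}. \<F> i \<noteq> {} \<and> card (\<F> i) \<le> K \<and> (\<forall>A\<in>\<F> i. A \<subseteq> {1..u} \<and> card A \<le> k))"

definition covers :: "nat \<Rightarrow> (nat \<Rightarrow> nat set set) \<Rightarrow> nat set \<Rightarrow> bool" where
  "covers c \<F> W \<longleftrightarrow> (\<forall>i\<in>{1..c}. \<exists>A\<in>\<F> i. A \<subseteq> W)"

definition witness_supersets ::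
    "nat \<Rightarrow> nat \<Rightarrow> nat \<Rightarrow> (nat \<Rightarrow> nat set set) \<Rightarrow> nat set set" where
  "witness_supersets k u c \<F> =
     {W. W \<subseteq> {1..u} \<and> covers c \<F> W \<and> card W \<le> k \<and> (\<forall>V. V \<subset> W \<longrightarrow> \<not> covers c \<F> V)}"

end

theory Submission
  imports Defs
begin

text \<open>
  A set \<open>W\<close> with at most \<open>k\<close> elements covers all families iff every tuple in \<open>S\<close> has an entry in
  \<open>C W\<close>, so \<open>S\<close> decides the covering condition. To find candidates, consider the slices
  \<open>{y. s[p := y] \<in> S}\<close>: each is the code of a union of members of the families. If \<open>W\<close> is a
  solution and \<open>x \<in> W\<close>, minimality yields a slice lying between \<open>C x\<close> and \<open>C W\<close>. Hence every
  solution is reached from the empty code by at most \<open>k\<close> unions with slices through decodable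
  codes, and a branching search over the at most \<open>K * q ^ K\<close> slices finds it. The program does not
  know \<open>k\<close>; the decoder rejects codes of sets with more than \<open>k\<close> elements, which bounds the depth.
  Non-minimal covers are discarded by keeping an antichain.
\<close>

text \<open>The decoder keeps its time bound only on repetition-free lists of subsets of [q], so it
  cannot be handled as a polynomial-time function on all trees. It is called from one explicit loop,
  and the rest of an iteration is a single total function, \<open>search_step\<close>, whose
  polynomial time follows from closure properties alone. The language has neither recursion nor
  equality, so both the search tree and the comparison of trees need an explicit stack. The loop is
  bounded by a potential. A union of slices is a code \<open>Y\<close>, which is recovered from the
  set of all \<open>x\<close> whose code lies in \<open>Y\<close>; hence each proper extension
  enlarges this set. With N = |S| K bounding the number of children, the weight (N + 1) ^
  \<open>rank\<close> of a code exceeds the total weight of its children, and at most (N + 1) ^ (k +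
  1) iterations occur. As |S| <= q ^ K, this is the source of the exponent O(K k). The final bound
  is a bare power of K k log u, a base that may equal 1. Constants must therefore be turned into
  powers or, if K = k = 1, into the leading factor.\<close>

section \<open>Polynomial-time functions on trees\<close>

text \<open>The base \<open>size v + 2\<close> is at least 2, so a constant factor is absorbed by the exponent.\<close>

definition poly_bounded :: "(tree \<Rightarrow> nat) \<Rightarrow> bool" where
  "poly_bounded h \<longleftrightarrow> (\<exists>b. \<forall>v. h v \<le> (size v + 2) ^ b)"

lemma poly_boundedI: "(\<And>v. h v \<le> (size v + 2) ^ b) \<Longrightarrow> poly_bounded h"
  unfolding poly_bounded_def by blast

lemma poly_bounded_mono:
  assumes "poly_bounded h" "\<And>v. h' v \<le> h v"
  shows "poly_bounded h'"
  using assms unfolding poly_bounded_def by (meson le_trans)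

lemma poly_bounded_const: "poly_bounded (\<lambda>_. n)"
proof (rule poly_boundedI)
  fix v :: tree
  have "n \<le> 2 ^ n" by (simp add: less_imp_le)
  also have "\<dots> \<le> (size v + 2) ^ n" by (intro power_mono) auto
  finally show "n \<le> (size v + 2) ^ n" .
qed

lemma poly_bounded_size: "poly_bounded size"
  by (rule poly_boundedI[where b = 1]) simp

lemma poly_bounded_add:
  assumes "poly_bounded g" "poly_bounded h"
  shows "poly_bounded (\<lambda>v. g v + h v)"
proof -
  obtain b c where b: "\<And>v. g v \<le> (size v + 2) ^ b" and c: "\<And>v. h v \<le> (size v + 2) ^ c"
    using assms unfolding poly_bounded_def by blast
  show ?thesis
  proof (rule poly_boundedI)
    fix v :: tree
    have "g v \<le> (size v + 2) ^ (b + c)" "h v \<le> (size v + 2) ^ (b + c)"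
      using b[of v] c[of v] by (meson le_trans power_increasing le_add1 le_add2 trans_le_add2
          one_le_numeral)+
    then have "g v + h v \<le> 2 * (size v + 2) ^ (b + c)" by simp
    also have "\<dots> \<le> (size v + 2) * (size v + 2) ^ (b + c)" by (intro mult_right_mono) auto
    finally show "g v + h v \<le> (size v + 2) ^ Suc (b + c)" by simp
  qed
qed

lemma poly_bounded_mult:
  assumes "poly_bounded g" "poly_bounded h"
  shows "poly_bounded (\<lambda>v. g v * h v)"
proof -
  obtain b c where "\<And>v. g v \<le> (size v + 2) ^ b" "\<And>v. h v \<le> (size v + 2) ^ c"
    using assms unfolding poly_bounded_def by blast
  then have "\<And>v. g v * h v \<le> (size v + 2) ^ (b + c)"
    by (simp add: power_add mult_le_mono)
  then show ?thesis by (rule poly_boundedI)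
qed

lemma poly_bounded_power: "poly_bounded h \<Longrightarrow> poly_bounded (\<lambda>v. h v ^ n)"
  by (induction n) (auto intro: poly_bounded_const poly_bounded_mult)

lemma poly_bounded_comp:
  assumes "poly_bounded h" "poly_bounded (\<lambda>v. size (f v))"
  shows "poly_bounded (\<lambda>v. h (f v))"
proof -
  obtain b where b: "\<And>v. h v \<le> (size v + 2) ^ b"
    using assms(1) unfolding poly_bounded_def by blast
  have "poly_bounded (\<lambda>v. (size (f v) + 2) ^ b)"
    by (intro poly_bounded_power poly_bounded_add poly_bounded_const assms)
  then show ?thesis by (rule poly_bounded_mono) (rule b)
qed

lemma size_left: "size (left v) \<le> size v" and size_right: "size (right v) \<le> size v"
  by (cases v; simp)+

lemma size_left_right: "size (left v) + size (right v) \<le> size v"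
  by (cases v) auto

lemma poly_bounded_left: "poly_bounded (\<lambda>v. size (left v))"
  and poly_bounded_right: "poly_bounded (\<lambda>v. size (right v))"
  by (rule poly_bounded_mono[OF poly_bounded_size], rule size_left size_right)+

text \<open>
  The output size is bounded separately because a program that shares subtrees can build trees
  of exponential size in linear time.
\<close>

definition ptime :: "(tree \<Rightarrow> tree) \<Rightarrow> bool" where
  "ptime f \<longleftrightarrow> poly_bounded (\<lambda>v. size (f v)) \<and>
     (\<exists>P h. poly_bounded h \<and> (\<forall>v. \<exists>t\<le>h v. runs P v t (f v)))"

lemma ptimeI:
  assumes "poly_bounded (\<lambda>v. size (f v))" "poly_bounded h"
    and "\<And>v. \<exists>t s. exec P (init v) t s \<and> s 0 = f v \<and> t \<le> h v"
  shows "ptime f"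
  unfolding ptime_def runs_def using assms by blast

lemma ptime_size: "ptime f \<Longrightarrow> poly_bounded (\<lambda>v. size (f v))"
  unfolding ptime_def by blast

lemma ptimeE:
  assumes "ptime f"
  obtains P h where "poly_bounded h" "\<And>v. \<exists>t s. exec P (init v) t s \<and> s 0 = f v \<and> t \<le> h v"
  using assms unfolding ptime_def runs_def by blast

lemma exec_Assign:
  "s' = s(x := val e s) \<Longrightarrow> t = 1 + cost e \<Longrightarrow> exec (Assign x e) s t s'"
  using exec.Assign by simp

lemma exec_Call:
  "exec c (init (val e s)) t s' \<Longrightarrow> s'' = s(x := s' 0) \<Longrightarrow> t' = 1 + cost e + t \<Longrightarrow>
    exec (Call x c e) s t' s''"
  using exec.Call by simp

lemma ex_execI:
  "exec c s t s' \<Longrightarrow> Q t s' \<Longrightarrow> \<exists>t s'. exec c s t s' \<and> Q t s'"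
  by blast

lemma init_simps [simp]: "init v 0 = v" "x \<noteq> 0 \<Longrightarrow> init v x = Leaf"
  by (simp_all add: init_def)

section \<open>Closure under composition, pairing and case distinction\<close>

lemma ptime_exp:
  assumes "poly_bounded (\<lambda>v. size (val e (init v)))"
  shows "ptime (\<lambda>v. val e (init v))"
  by (rule ptimeI[OF assms poly_bounded_const, where P = "Assign 0 e"])
     (blast intro: exec_Assign[OF refl refl] fun_upd_same)

lemma ptime_id: "ptime (\<lambda>v. v)"
  using ptime_exp[of "Var 0"] by (simp add: poly_bounded_size)

lemma ptime_Leaf: "ptime (\<lambda>_. Leaf)"
  using ptime_exp[of "Empty"] by (simp add: poly_bounded_const)

text \<open>The program for \<open>f\<close> is timed on \<open>g v\<close>, so the size clause for
  \<open>g\<close> is what keeps the total time polynomial. \<open>Call\<close> gives each program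
  its own variables, hence the two cannot interfere.\<close>

lemma ptime_comp:
  assumes "ptime f" "ptime g"
  shows "ptime (\<lambda>v. f (g v))"
proof -
  obtain P h where h: "poly_bounded h"
    and P: "\<And>v. \<exists>t s. exec P (init v) t s \<and> s 0 = f v \<and> t \<le> h v"
    by (rule ptimeE[OF assms(1)]) (rule that)
  obtain Q h' where h': "poly_bounded h'"
    and Q: "\<And>v. \<exists>t s. exec Q (init v) t s \<and> s 0 = g v \<and> t \<le> h' v"
    by (rule ptimeE[OF assms(2)]) (rule that)
  let ?c = "Seq (Call 0 Q (Var 0)) (Call 0 P (Var 0))"
  show ?thesis
  proof (rule ptimeI[where P = ?c and h = "\<lambda>v. h' v + h (g v) + 4"])
    show "poly_bounded (\<lambda>v. size (f (g v)))"
      by (rule poly_bounded_comp[OF assms[THEN ptime_size]])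
    show "poly_bounded (\<lambda>v. h' v + h (g v) + 4)"
      by (intro poly_bounded_add h' poly_bounded_comp[OF h] ptime_size assms(2) poly_bounded_const)
    fix v
    obtain t s where 1: "exec Q (init v) t s" "s 0 = g v" "t \<le> h' v" using Q by blast
    obtain t' s' where 2: "exec P (init (g v)) t' s'" "s' 0 = f (g v)" "t' \<le> h (g v)"
      using P by blast
    have "exec ?c (init v) ((1 + cost (Var 0) + t) + (1 + cost (Var 0) + t'))
        ((init v)(0 := s 0, 0 := s' 0))"
      by (rule exec.Seq[where ?s2.0 = "(init v)(0 := s 0)"])
         (rule exec_Call[where s' = s], use 1 in auto, rule exec_Call[where s' = s'], use 1 2 in auto)
    then show "\<exists>t s. exec ?c (init v) t s \<and> s 0 = f (g v) \<and> t \<le> h' v + h (g v) + 4"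
      by (rule ex_execI) (use 1 2 in auto)
  qed
qed

lemma ptime_left: "ptime f \<Longrightarrow> ptime (\<lambda>v. left (f v))"
  using ptime_exp[of "Left (Var 0)"] by (auto intro: ptime_comp[of left f] simp: poly_bounded_left)

lemma ptime_right: "ptime f \<Longrightarrow> ptime (\<lambda>v. right (f v))"
  using ptime_exp[of "Right (Var 0)"] by (auto intro: ptime_comp[of right f] simp: poly_bounded_right)

lemma ptime_Node:
  assumes "ptime f" "ptime g"
  shows "ptime (\<lambda>v. Node (f v) (g v))"
proof -
  obtain P h where h: "poly_bounded h"
    and P: "\<And>v. \<exists>t s. exec P (init v) t s \<and> s 0 = f v \<and> t \<le> h v"
    by (rule ptimeE[OF assms(1)]) (rule that)
  obtain Q h' where h': "poly_bounded h'"
    and Q: "\<And>v. \<exists>t s. exec Q (init v) t s \<and> s 0 = g v \<and> t \<le> h' v"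
    by (rule ptimeE[OF assms(2)]) (rule that)
  let ?c = "Seq (Call 5 P (Var 0)) (Seq (Call 2 Q (Var 0)) (Assign 0 (Pair (Var 5) (Var 2))))"
  show ?thesis
  proof (rule ptimeI[where P = ?c and h = "\<lambda>v. h v + h' v + 8"])
    show "poly_bounded (\<lambda>v. size (Node (f v) (g v)))"
      using poly_bounded_add[OF poly_bounded_add[OF ptime_size[OF assms(1)] ptime_size[OF assms(2)]]
          poly_bounded_const[of 1]] by simp
    show "poly_bounded (\<lambda>v. h v + h' v + 8)"
      using h h' by (intro poly_bounded_add poly_bounded_const)
    fix v
    obtain t s where 1: "exec P (init v) t s" "s 0 = f v" "t \<le> h v" using P by blast
    obtain t' s' where 2: "exec Q (init v) t' s'" "s' 0 = g v" "t' \<le> h' v" using Q by blast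
    have "exec ?c (init v) ((2 + t) + ((2 + t') + 4))
        ((init v)(5 := f v, 2 := g v, 0 := Node (f v) (g v)))"
      by (intro exec.Seq) (rule exec_Call exec_Assign, use 1 2 in auto)+
    then show "\<exists>t s. exec ?c (init v) t s \<and> s 0 = Node (f v) (g v) \<and> t \<le> h v + h' v + 8"
      by (rule ex_execI) (use 1 2 in auto)
  qed
qed

abbreviation tree_of_bool :: "bool \<Rightarrow> tree" where
  "tree_of_bool b \<equiv> (if b then Node Leaf Leaf else Leaf)"

definition ptime_pred :: "(tree \<Rightarrow> bool) \<Rightarrow> bool" where
  "ptime_pred Q \<longleftrightarrow> ptime (\<lambda>v. tree_of_bool (Q v))"

lemma ptime_if:
  assumes "ptime_pred B" "ptime f" "ptime g"
  shows "ptime (\<lambda>v. if B v then f v else g v)"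
proof -
  obtain R h'' where h'': "poly_bounded h''"
    and R: "\<And>v. \<exists>t s. exec R (init v) t s \<and> s 0 = tree_of_bool (B v) \<and> t \<le> h'' v"
    by (rule ptimeE[OF assms(1)[unfolded ptime_pred_def]]) (rule that)
  obtain P h where h: "poly_bounded h"
    and P: "\<And>v. \<exists>t s. exec P (init v) t s \<and> s 0 = f v \<and> t \<le> h v"
    by (rule ptimeE[OF assms(2)]) (rule that)
  obtain Q h' where h': "poly_bounded h'"
    and Q: "\<And>v. \<exists>t s. exec Q (init v) t s \<and> s 0 = g v \<and> t \<le> h' v"
    by (rule ptimeE[OF assms(3)]) (rule that)
  let ?c = "Seq (Call 5 R (Var 0)) (Cond (Var 5) (Call 0 P (Var 0)) (Call 0 Q (Var 0)))"
  let ?t = "\<lambda>v. h'' v + (h v + h' v) + 6"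
  show ?thesis
  proof (rule ptimeI[where P = ?c and h = ?t])
    show "poly_bounded (\<lambda>v. size (if B v then f v else g v))"
      by (rule poly_bounded_mono[OF poly_bounded_add[OF ptime_size[OF assms(2)]
              ptime_size[OF assms(3)]]]) simp
    show "poly_bounded ?t"
      using h h' h'' by (intro poly_bounded_add poly_bounded_const)
    fix v
    obtain t'' s'' where 0: "exec R (init v) t'' s''" "s'' 0 = tree_of_bool (B v)" "t'' \<le> h'' v"
      using R by blast
    obtain t s where 1: "exec P (init v) t s" "s 0 = f v" "t \<le> h v" using P by blast
    obtain t' s' where 2: "exec Q (init v) t' s'" "s' 0 = g v" "t' \<le> h' v" using Q by blast
    have R: "exec (Call 5 R (Var 0)) (init v) (2 + t'') ((init v)(5 := s'' 0))"
      by (rule exec_Call[where t = t'' and s' = s'']) (simp_all add: 0(1))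
    show "\<exists>t s. exec ?c (init v) t s \<and> s 0 = (if B v then f v else g v) \<and> t \<le> ?t v"
    proof (cases "B v")
      case True
      have "exec ?c (init v) ((2 + t'') + (1 + cost (Var 5) + (2 + t)))
          ((init v)(5 := s'' 0, 0 := f v))"
        by (rule exec.Seq[OF R], rule exec.CondTrue) (use True 0 in simp, rule exec_Call[where s' = s], use 1 in auto)
      then show ?thesis
      by (rule ex_execI) (use True 0 1 in auto)
    next
      case False
      have "exec ?c (init v) ((2 + t'') + (1 + cost (Var 5) + (2 + t')))
          ((init v)(5 := s'' 0, 0 := g v))"
        by (rule exec.Seq[OF R], rule exec.CondFalse) (use False 0 in simp, rule exec_Call[where s' = s'], use 2 in auto)
      then show ?thesis
      by (rule ex_execI) (use False 0 2 in auto)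
    qed
  qed
qed

lemma ptime_pred_not:
  assumes "ptime_pred Q"
  shows "ptime_pred (\<lambda>v. \<not> Q v)"
proof -
  have "ptime (\<lambda>v. if Q v then Leaf else Node Leaf Leaf)"
    by (intro ptime_if assms ptime_Leaf ptime_Node)
  moreover have "(\<lambda>v. if Q v then Leaf else Node Leaf Leaf) = (\<lambda>v. tree_of_bool (\<not> Q v))"
    by auto
  ultimately show ?thesis unfolding ptime_pred_def by metis
qed

lemma ptime_pred_conj:
  assumes "ptime_pred Q" "ptime_pred R"
  shows "ptime_pred (\<lambda>v. Q v \<and> R v)"
proof -
  have "ptime (\<lambda>v. if Q v then tree_of_bool (R v) else Leaf)"
    by (intro ptime_if assms ptime_Leaf assms(2)[unfolded ptime_pred_def])
  moreover have "(\<lambda>v. if Q v then tree_of_bool (R v) else Leaf) = (\<lambda>v. tree_of_bool (Q v \<and> R v))"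
    by auto
  ultimately show ?thesis unfolding ptime_pred_def by metis
qed

text \<open>A binary function is presented as a function on pairs; the rule converts this into a
  form that \<open>intro\<close> can use with arbitrary argument functions.\<close>

lemma ptime_app2:
  assumes "ptime (\<lambda>w. F (left w) (right w))" "ptime f" "ptime g"
  shows "ptime (\<lambda>v. F (f v) (g v))"
  using ptime_comp[OF assms(1) ptime_Node[OF assms(2,3)]] by simp

lemma ptime_pred_app2:
  assumes "ptime_pred (\<lambda>w. F (left w) (right w))" "ptime f" "ptime g"
  shows "ptime_pred (\<lambda>v. F (f v) (g v))"
  using ptime_app2[where F = "\<lambda>a b. tree_of_bool (F a b)"] assms unfolding ptime_pred_def by blast


subsection \<open>Equality of trees\<close>

text \<open>There is no recursion, so variable 5 holds a stack of pairs that remain to be compared.\<close>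

definition eq_body :: com where
  "eq_body =
     Seq (Assign 3 (Left (Left (Var 5))))
    (Seq (Assign 4 (Right (Left (Var 5))))
    (Seq (Assign 5 (Right (Var 5)))
    (Cond (Var 3)
      (Cond (Var 4)
        (Assign 5 (Pair (Pair (Left (Var 3)) (Left (Var 4)))
          (Pair (Pair (Right (Var 3)) (Right (Var 4))) (Var 5))))
        (Assign 2 Empty))
      (Cond (Var 4) (Assign 2 Empty) Skip))))"

definition eq_com :: com where
  "eq_com =
     Seq (Assign 5 (Pair (Pair (Left (Var 0)) (Right (Var 0))) Empty))
    (Seq (Assign 2 (Pair Empty Empty))
    (Seq (While (Var 5) eq_body)
    (Assign 0 (Var 2))))"

lemma eq_body_exec:
  assumes "s 5 = Node (Node a b) st"
  shows "\<exists>t s'. exec eq_body s t s' \<and> t \<le> 40 \<and>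
     s' 5 = (if a \<noteq> Leaf \<and> b \<noteq> Leaf
             then Node (Node (left a) (left b)) (Node (Node (right a) (right b)) st) else st) \<and>
     s' 2 = (if (a = Leaf) = (b = Leaf) then s 2 else Leaf)"
proof -
  let ?s = "s(3 := a, 4 := b, 5 := st)"
  let ?c = "Cond (Var 3)
      (Cond (Var 4)
        (Assign 5 (Pair (Pair (Left (Var 3)) (Left (Var 4)))
          (Pair (Pair (Right (Var 3)) (Right (Var 4))) (Var 5))))
        (Assign 2 Empty))
      (Cond (Var 4) (Assign 2 Empty) Skip)"
  have pre: "exec eq_body s (4 + (4 + (3 + t))) s'" if "exec ?c ?s t s'" for t s'
    unfolding eq_body_def
    by (intro exec.Seq) (rule exec_Assign, use assms in simp, simp, rule exec_Assign,
        use assms in simp, simp, rule exec_Assign, use assms in simp, simp, rule that)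
  consider "a \<noteq> Leaf" "b \<noteq> Leaf" | "a \<noteq> Leaf" "b = Leaf" | "a = Leaf" "b \<noteq> Leaf"
    | "a = Leaf" "b = Leaf" by blast
  then show ?thesis
  proof cases
    case 1
    have "exec ?c ?s (1 + cost (Var 3) + (1 + cost (Var 4) + 14))
        (?s(5 := Node (Node (left a) (left b)) (Node (Node (right a) (right b)) st)))"
      by (intro exec.CondTrue) (use 1 in simp, use 1 in simp, rule exec_Assign, auto)
    from pre[OF this] show ?thesis by (rule ex_execI) (use 1 in auto)
  next
    case 2
    have "exec ?c ?s (1 + cost (Var 3) + (1 + cost (Var 4) + 2)) (?s(2 := Leaf))"
      by (rule exec.CondTrue, use 2 in simp, rule exec.CondFalse, use 2 in simp, rule exec_Assign)
         auto
    from pre[OF this] show ?thesis by (rule ex_execI) (use 2 in auto)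
  next
    case 3
    have "exec ?c ?s (1 + cost (Var 3) + (1 + cost (Var 4) + 2)) (?s(2 := Leaf))"
      by (rule exec.CondFalse, use 3 in simp, rule exec.CondTrue, use 3 in simp, rule exec_Assign)
         auto
    from pre[OF this] show ?thesis by (rule ex_execI) (use 3 in auto)
  next
    case 4
    have "exec ?c ?s (1 + cost (Var 3) + (1 + cost (Var 4) + 1)) ?s"
      by (rule exec.CondFalse, use 4 in simp, rule exec.CondFalse, use 4 in simp, rule exec.Skip)
    from pre[OF this] show ?thesis by (rule ex_execI) (use 4 in auto)
  qed
qed

text \<open>The rest of the stack and the rest of the run are left open, so that the runs for the
  two subtrees can be chained. A mismatch clears variable 2 without stopping the loop, so the stack
  is always worked down to \<open>st\<close>. Counting leaves, \<open>a\<close> has 2 *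
  \<open>size a\<close> + 1 nodes; each popped pair costs at most 40 steps and 2 for the loop
  test.\<close>

lemma eq_while_exec:
  assumes "s 5 = Node (Node a b) st"
  shows "\<exists>t s1. t \<le> 42 * (2 * size a + 1) \<and> s1 5 = st \<and> s1 2 = (if a = b then s 2 else Leaf) \<and>
     (\<forall>t' s'. exec (While (Var 5) eq_body) s1 t' s' \<longrightarrow>
        exec (While (Var 5) eq_body) s (t + t') s')"
  using assms
proof (induction a arbitrary: b s st)
  case Leaf
  obtain t s1 where 1: "exec eq_body s t s1" "t \<le> 40" "s1 5 = st"
      "s1 2 = (if Leaf = b then s 2 else Leaf)"
    using eq_body_exec[of s Leaf b st] Leaf by force
  have "exec (While (Var 5) eq_body) s (2 + t + t') s'"
    if "exec (While (Var 5) eq_body) s1 t' s'" for t' s'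
    using exec.WhileTrue[OF _ 1(1) that] Leaf by simp
  then show ?case using 1 by (intro exI[of _ "2 + t"] exI[of _ s1]) auto
next
  case (Node al ar)
  show ?case
  proof (cases b)
    case Leaf
    obtain t s1 where 1: "exec eq_body s t s1" "t \<le> 40" "s1 5 = st" "s1 2 = Leaf"
      using eq_body_exec[of s "Node al ar" b st] Node.prems Leaf by force
    have "exec (While (Var 5) eq_body) s (2 + t + t') s'"
      if "exec (While (Var 5) eq_body) s1 t' s'" for t' s'
      using exec.WhileTrue[OF _ 1(1) that] Node.prems by simp
    then show ?thesis using 1 Leaf by (intro exI[of _ "2 + t"] exI[of _ s1]) auto
  next
    case b: (Node bl br)
    obtain t s1 where 1: "exec eq_body s t s1" "t \<le> 40"
        "s1 5 = Node (Node al bl) (Node (Node ar br) st)" "s1 2 = s 2"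
      using eq_body_exec[of s "Node al ar" b st] Node.prems b by auto
    obtain t2 s2 where 2: "t2 \<le> 42 * (2 * size al + 1)" "s2 5 = Node (Node ar br) st"
        "s2 2 = (if al = bl then s1 2 else Leaf)"
        "\<And>t' s'. exec (While (Var 5) eq_body) s2 t' s' \<Longrightarrow>
          exec (While (Var 5) eq_body) s1 (t2 + t') s'"
      using Node.IH(1)[where s = s1] 1(3) by blast
    obtain t3 s3 where 3: "t3 \<le> 42 * (2 * size ar + 1)" "s3 5 = st"
        "s3 2 = (if ar = br then s2 2 else Leaf)"
        "\<And>t' s'. exec (While (Var 5) eq_body) s3 t' s' \<Longrightarrow>
          exec (While (Var 5) eq_body) s2 (t3 + t') s'"
      using Node.IH(2)[where s = s2] 2(2) by blast
    have "exec (While (Var 5) eq_body) s (2 + t + t2 + t3 + t') s'"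
      if "exec (While (Var 5) eq_body) s3 t' s'" for t' s'
      using exec.WhileTrue[OF _ 1(1) 2(4)[OF 3(4)[OF that]]] Node.prems
      by (simp add: add.assoc)
    then show ?thesis using 1 2 3 b
      by (intro exI[of _ "2 + t + t2 + t3"] exI[of _ s3]) auto
  qed
qed

lemma ptime_pred_eq:
  assumes "ptime f" "ptime g"
  shows "ptime_pred (\<lambda>v. f v = g v)"
proof -
  have "\<exists>t s. exec eq_com (init v) t s \<and> s 0 = tree_of_bool (left v = right v) \<and>
      t \<le> 84 * size v + 100" for v
  proof -
    let ?s = "(init v)(5 := Node (Node (left v) (right v)) Leaf, 2 := Node Leaf Leaf)"
    obtain t s1 where 1: "t \<le> 42 * (2 * size (left v) + 1)" "s1 5 = Leaf"
        "s1 2 = (if left v = right v then ?s 2 else Leaf)"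
        "\<And>t' s'. exec (While (Var 5) eq_body) s1 t' s' \<Longrightarrow>
          exec (While (Var 5) eq_body) ?s (t + t') s'"
      using eq_while_exec[where s = ?s and a = "left v" and b = "right v" and st = Leaf] by auto
    have "exec (While (Var 5) eq_body) s1 (1 + cost (Var 5)) s1"
      using 1 by (intro exec.WhileFalse) simp
    from 1(4)[OF this]
    have "exec eq_com (init v) (8 + (4 + ((t + (1 + cost (Var 5))) + 2))) (s1(0 := s1 2))"
      unfolding eq_com_def
      by (intro exec.Seq) (rule exec_Assign, simp, simp, rule exec_Assign, simp, simp, assumption,
          rule exec_Assign, auto)
    then show ?thesis
      by (rule ex_execI) (use 1 size_left[of v] in auto)
  qed
  then have "ptime (\<lambda>v. tree_of_bool (left v = right v))"
    by (intro ptimeI[where P = eq_com and h = "\<lambda>v. 84 * size v + 100"]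
        poly_bounded_add poly_bounded_mult poly_bounded_const poly_bounded_size
        poly_bounded_mono[OF poly_bounded_const[of 1]]) auto
  then show ?thesis
    using assms unfolding ptime_pred_def
    by (rule ptime_app2[where F = "\<lambda>a b. tree_of_bool (a = b)"])
qed

subsection \<open>Iteration over lists\<close>

text \<open>Every tree is the encoding of a list of trees.\<close>

fun elems :: "tree \<Rightarrow> tree list" where
  "elems Leaf = []"
| "elems (Node x l) = x # elems l"

lemma elems_enc_list [simp]: "elems (enc_list f xs) = map f xs"
  by (induction xs) auto

lemma length_elems_le: "length (elems l) \<le> size l"
  by (induction l) auto

lemma size_elems_le: "x \<in> set (elems l) \<Longrightarrow> size x < size l"
  by (induction l) auto

definition fold_while :: "com \<Rightarrow> com" where
  "fold_while P = While (Var 2)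
     (Seq (Call 3 P (Pair (Var 5) (Pair (Left (Var 2)) (Var 3)))) (Assign 2 (Right (Var 2))))"

text \<open>The growth of the accumulator in one round depends only on the environment and the
  element; a bound polynomial in the accumulator itself could be iterated to exponential size. Thus
  \<open>z\<close> bounds it throughout, and each round runs \<open>P\<close> on an argument of size
  at most \<open>n + z + 2\<close>.\<close>

lemma fold_while_exec:
  assumes P: "\<And>e x a. \<exists>t s. exec P (init (Node e (Node x a))) t s \<and> s 0 = g e x a \<and>
      t \<le> (size (Node e (Node x a)) + 2) ^ b"
    and growth: "\<And>e x a. size (g e x a) \<le> size a + (size (Node e x) + 2) ^ c"
    and "s 5 = e" "s 2 = l" "s 3 = a"
    and "size e + size l \<le> n" "size a + length (elems l) * (n + 3) ^ c \<le> z"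
  shows "\<exists>t s'. exec (fold_while P) s t s' \<and> s' 3 = fold (g e) (elems l) a \<and>
    size (fold (g e) (elems l) a) \<le> z \<and> t \<le> 2 + length (elems l) * ((n + z + 4) ^ b + 12)"
  using assms(3-)
proof (induction l arbitrary: s a)
  case Leaf
  have "exec (fold_while P) s (1 + cost (Var 2)) s"
    unfolding fold_while_def by (rule exec.WhileFalse) (simp add: Leaf)
  then show ?case by (rule ex_execI) (use Leaf in auto)
next
  case (Node x l)
  obtain t s' where 1: "exec P (init (Node e (Node x a))) t s'" "s' 0 = g e x a"
      "t \<le> (size (Node e (Node x a)) + 2) ^ b" using P by blast
  have t: "t \<le> (n + z + 4) ^ b"
    using 1(3) by (rule le_trans) (intro power_mono, use Node.prems in auto)
  have "size (g e x a) \<le> size a + (size (Node e x) + 2) ^ c" by (rule growth)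
  also have "(size (Node e x) + 2) ^ c \<le> (n + 3) ^ c"
    by (intro power_mono) (use Node.prems in auto)
  finally have "size (g e x a) + length (elems l) * (n + 3) ^ c \<le> z"
    using Node.prems by simp
  moreover have "size e + size l \<le> n" "(s(3 := g e x a, 2 := l)) 5 = e"
      "(s(3 := g e x a, 2 := l)) 2 = l" "(s(3 := g e x a, 2 := l)) 3 = g e x a"
    using Node.prems by auto
  ultimately obtain t2 s2 where 2: "exec (fold_while P) (s(3 := g e x a, 2 := l)) t2 s2"
      "s2 3 = fold (g e) (elems l) (g e x a)" "size (fold (g e) (elems l) (g e x a)) \<le> z"
      "t2 \<le> 2 + length (elems l) * ((n + z + 4) ^ b + 12)"
    using Node.IH(2) by blast
  have "exec (fold_while P) s (1 + cost (Var 2) + ((7 + t) + 3) + t2) s2"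
    unfolding fold_while_def
    by (rule exec.WhileTrue[OF _ _ 2(1)[unfolded fold_while_def]], use Node.prems in simp)
       (rule exec.Seq, rule exec_Call[where s' = s'], use 1 Node.prems in simp, simp, simp,
         rule exec_Assign, use 1 Node.prems in auto)
  then show ?case by (rule ex_execI) (use 2 t in \<open>auto simp: algebra_simps\<close>)
qed

lemma ptime_fold_proj:
  assumes g: "ptime (\<lambda>w. g (left w) (left (right w)) (right (right w)))"
    and r: "poly_bounded r" "\<And>e x a. size (g e x a) \<le> size a + r (Node e x)"
  shows "ptime (\<lambda>v. fold (g (left v)) (elems (left (right v))) (right (right v)))"
proof -
  obtain P h where h: "poly_bounded h" and P: "\<And>v. \<exists>t s. exec P (init v) t s \<and>
      s 0 = g (left v) (left (right v)) (right (right v)) \<and> t \<le> h v"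
    by (rule ptimeE[OF g]) (rule that)
  obtain b where b: "\<And>v. h v \<le> (size v + 2) ^ b"
    using h unfolding poly_bounded_def by blast
  obtain c where c: "\<And>v. r v \<le> (size v + 2) ^ c"
    using r(1) unfolding poly_bounded_def by blast
  let ?z = "\<lambda>v. size v + size v * (size v + 3) ^ c"
  let ?t = "\<lambda>v. size v * ((size v + ?z v + 4) ^ b + 12) + 20"
  let ?c = "Seq (Assign 5 (Left (Var 0))) (Seq (Assign 2 (Left (Right (Var 0))))
      (Seq (Assign 3 (Right (Right (Var 0)))) (Seq (fold_while P) (Assign 0 (Var 3)))))"
  have P': "\<exists>t s. exec P (init (Node e (Node x a))) t s \<and> s 0 = g e x a \<and>
      t \<le> (size (Node e (Node x a)) + 2) ^ b" for e x a
    using P[of "Node e (Node x a)"] b[of "Node e (Node x a)"] by (auto intro: le_trans)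
  have c': "size (g e x a) \<le> size a + (size (Node e x) + 2) ^ c" for e x a
    using r(2)[of e x a] c[of "Node e x"] by simp
  have main: "(\<exists>t s. exec ?c (init v) t s \<and>
      s 0 = fold (g (left v)) (elems (left (right v))) (right (right v)) \<and> t \<le> ?t v) \<and>
      size (fold (g (left v)) (elems (left (right v))) (right (right v))) \<le> ?z v" for v
  proof -
    let ?f = "fold (g (left v)) (elems (left (right v))) (right (right v))"
    let ?s = "(init v)(5 := left v, 2 := left (right v), 3 := right (right v))"
    have len: "length (elems (left (right v))) \<le> size v"
      using length_elems_le[of "left (right v)"] size_left[of "right v"] size_right[of v] by simp
    have sz: "size (right (right v)) \<le> size v" "size (left v) + size (left (right v)) \<le> size v"
      using size_right[of "right v"] size_right[of v] size_left[of "right v"] size_left_right[of v]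
      by auto
    obtain t s' where 1: "exec (fold_while P) ?s t s'" "s' 3 = ?f" "size ?f \<le> ?z v"
        "t \<le> 2 + length (elems (left (right v))) * ((size v + ?z v + 4) ^ b + 12)"
      using fold_while_exec[OF P' c', of ?s "left v" "left (right v)" "right (right v)" "size v" "?z v"]
        sz len by (force intro: add_mono mult_le_mono)
    have "t \<le> 2 + size v * ((size v + ?z v + 4) ^ b + 12)"
      using 1(4) mult_le_mono1[OF len, of "(size v + ?z v + 4) ^ b + 12"] by linarith
    moreover have "exec ?c (init v) (3 + (4 + (4 + (t + 2)))) (s'(0 := s' 3))"
      by (intro exec.Seq) (rule exec_Assign, simp, simp, rule exec_Assign, simp, simp,
          rule exec_Assign, simp, simp, rule 1, rule exec_Assign, auto)
    then have "\<exists>t s. exec ?c (init v) t s \<and> s 0 = ?f \<and> t \<le> ?t v"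
      by (rule ex_execI) (use calculation 1 in auto)
    then show ?thesis using 1(3) by blast
  qed
  have z: "poly_bounded ?z"
    by (intro poly_bounded_add poly_bounded_mult poly_bounded_power poly_bounded_const
        poly_bounded_size)
  show ?thesis
  proof (rule ptimeI)
    show "poly_bounded (\<lambda>v. size (fold (g (left v)) (elems (left (right v))) (right (right v))))"
      using z main by (blast intro: poly_bounded_mono)
    show "poly_bounded ?t"
      by (intro poly_bounded_add poly_bounded_mult poly_bounded_power poly_bounded_const
        poly_bounded_size)
  qed (use main in blast)
qed

text \<open>The environment handed to \<open>g\<close> is the whole input \<open>v\<close>, so the
  step may use everything in scope; this makes nested folds expressible.\<close>

lemma ptime_fold:
  assumes g: "ptime (\<lambda>w. g (left w) (left (right w)) (right (right w)))"
    and "ptime l" "ptime a"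
    and r: "poly_bounded r" "\<And>e x a. size (g e x a) \<le> size a + r (Node e x)"
  shows "ptime (\<lambda>v. fold (g v) (elems (l v)) (a v))"
  using ptime_comp[OF ptime_fold_proj[OF g r] ptime_Node[OF ptime_id ptime_Node[OF assms(2,3)]]]
  by simp

lemma ptime_pred_ex:
  assumes "ptime_pred (\<lambda>w. Q (left w) (right w))" "ptime l"
  shows "ptime_pred (\<lambda>v. \<exists>x\<in>set (elems (l v)). Q v x)"
proof -
  let ?g = "\<lambda>v x a. if Q v x then Node Leaf Leaf else a"
  have fold: "fold (?g v) xs a = (if \<exists>x\<in>set xs. Q v x then Node Leaf Leaf else a)" for v xs a
    by (induction xs arbitrary: a) auto
  have "ptime (\<lambda>v. fold (?g v) (elems (l v)) Leaf)"
    by (rule ptime_fold[where g = ?g and r = "\<lambda>_. 1"])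
       (use assms(2) in \<open>auto intro!: ptime_if ptime_Node ptime_Leaf ptime_left ptime_right ptime_id
         ptime_pred_app2[OF assms(1)] poly_bounded_const\<close>)
  then show ?thesis by (simp add: fold ptime_pred_def)
qed

lemma ptime_pred_all:
  assumes "ptime_pred (\<lambda>w. Q (left w) (right w))" "ptime l"
  shows "ptime_pred (\<lambda>v. \<forall>x\<in>set (elems (l v)). Q v x)"
  using ptime_pred_not[OF ptime_pred_ex[OF ptime_pred_not[OF assms(1)] assms(2)]] by simp

lemma ptime_pred_mem:
  assumes "ptime f" "ptime g"
  shows "ptime_pred (\<lambda>v. f v \<in> set (elems (g v)))"
proof -
  have "ptime_pred (\<lambda>v. \<exists>x\<in>set (elems (g v)). f v = x)"
    by (intro ptime_pred_ex ptime_pred_eq ptime_comp[OF assms(1)] ptime_left ptime_right ptime_id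
        assms(2))
  then show ?thesis by simp
qed

lemma ptime_pred_subset:
  assumes "ptime f" "ptime g"
  shows "ptime_pred (\<lambda>v. set (elems (f v)) \<subseteq> set (elems (g v)))"
  unfolding subset_eq
  by (intro ptime_pred_all ptime_pred_mem ptime_comp[OF assms(2)] ptime_left ptime_right ptime_id
      assms(1))

section \<open>Size bounds for folds\<close>

lemma size_fold_le:
  assumes "\<And>x a. x \<in> set xs \<Longrightarrow> size (g x a) \<le> size a + B x"
  shows "size (fold g xs (a :: tree)) \<le> size a + (\<Sum>x\<leftarrow>xs. B x)"
  using assms
proof (induction xs arbitrary: a)
  case (Cons x xs)
  have "size (fold g xs (g x a)) \<le> size (g x a) + (\<Sum>x\<leftarrow>xs. B x)"
    using Cons by simp
  then show ?case using Cons.prems[of x a] by simp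
qed simp

lemma size_eq_sum_elems: "size l = (\<Sum>x\<leftarrow>elems l. size x + 1)"
  by (induction l) auto


section \<open>The search step\<close>

definition rev_append :: "tree \<Rightarrow> tree \<Rightarrow> tree" where
  "rev_append l a = fold Node (elems l) a"

lemma ptime_rev_append:
  assumes "ptime f" "ptime g"
  shows "ptime (\<lambda>v. rev_append (f v) (g v))"
  unfolding rev_append_def
  by (rule ptime_fold[where g = "\<lambda>_. Node" and r = "\<lambda>w. size w"])
     (auto intro!: ptime_Node ptime_left ptime_right ptime_id assms poly_bounded_size)

text \<open>
  \<open>extend (Node ss (Node p q)) Y\<close> adds to \<open>Y\<close> all \<open>y\<close> such that the tuple \<open>rev p @ y # q\<close> is
  in \<open>ss\<close>.
\<close>

definition extend_step :: "tree \<Rightarrow> tree \<Rightarrow> tree \<Rightarrow> tree" where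
  "extend_step e y Z =
     (if rev_append (left (right e)) (Node y (right (right e))) \<in> set (elems (left e)) \<and>
         y \<notin> set (elems Z)
      then Node y Z else Z)"

definition extend :: "tree \<Rightarrow> tree \<Rightarrow> tree" where
  "extend e Y = fold (\<lambda>s. fold (extend_step e) (elems s)) (elems (left e)) Y"

lemma ptime_extend_step:
  assumes "ptime f" "ptime g" "ptime h"
  shows "ptime (\<lambda>v. extend_step (f v) (g v) (h v))"
  unfolding extend_step_def
  by (intro ptime_if ptime_pred_conj ptime_pred_not ptime_pred_mem ptime_rev_append ptime_Node
      ptime_left ptime_right assms)

lemma size_fold_extend_step:
  "size (fold (extend_step e) (elems s) Y) \<le> size Y + size s"
  unfolding size_eq_sum_elems[of s] by (rule size_fold_le) (simp add: extend_step_def)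

lemma size_extend: "size (extend e Y) \<le> size Y + size (left e)"
  unfolding extend_def size_eq_sum_elems[of "left e"]
  by (rule size_fold_le) (rule le_trans[OF size_fold_extend_step], simp)

lemma ptime_extend:
  assumes "ptime f" "ptime g"
  shows "ptime (\<lambda>v. extend (f v) (g v))"
proof -
  have "ptime (\<lambda>w. fold (extend_step (f (left w))) (elems (left (right w))) (right (right w)))"
    by (rule ptime_fold[where g = "\<lambda>w. extend_step (f (left w))" and r = "\<lambda>w. size w"])
       (auto simp: extend_step_def intro!: poly_bounded_size ptime_left ptime_right ptime_id
         ptime_extend_step[unfolded extend_step_def] ptime_comp[OF assms(1)])
  then show ?thesis
    unfolding extend_def
    by (intro ptime_fold[where g = "\<lambda>v s. fold (extend_step (f v)) (elems s)" and r = "\<lambda>w. size w"])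
       (auto intro!: poly_bounded_size ptime_left assms
         intro: le_trans[OF size_fold_extend_step])
qed

text \<open>
  The accumulator \<open>Node p (Node q st)\<close> walks through a tuple with \<open>p\<close> the reversed prefix and
  \<open>q\<close> the remaining suffix; \<open>v\<close> is \<open>Node Y ss\<close>.
\<close>

definition branch_step :: "tree \<Rightarrow> tree \<Rightarrow> tree \<Rightarrow> tree" where
  "branch_step v x a =
     Node (Node x (left a)) (Node (right (left (right a)))
      (if extend (Node (right v) (Node (left a) (right (left (right a))))) (left v) = left v
       then right (right a)
       else Node (extend (Node (right v) (Node (left a) (right (left (right a))))) (left v))
         (right (right a))))"

definition branch :: "tree \<Rightarrow> tree \<Rightarrow> tree \<Rightarrow> tree" where
  "branch v s st = right (right (fold (branch_step v) (elems s) (Node Leaf (Node s st))))"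

definition branches :: "tree \<Rightarrow> tree \<Rightarrow> tree" where
  "branches v st = fold (branch v) (elems (right v)) st"

text \<open>Each pushed code extends the fixed \<open>left v\<close> and is never built from the
  accumulator. Its size is therefore at most \<open>size v\<close>, which gives the additive growth
  that \<open>ptime_fold\<close> demands.\<close>

lemma size_branch_step: "size (branch_step v x a) \<le> size a + (size x + size v + 6)"
proof -
  let ?e = "Node (right v) (Node (left a) (right (left (right a))))"
  have "size (extend ?e (left v)) \<le> size v"
    using size_extend[of ?e "left v"] size_left_right[of v] by simp
  moreover have "size (left a) + (size (right (left (right a))) + size (right (right a))) \<le> size a"
    using size_left_right[of a] size_left_right[of "right a"] size_right[of "left (right a)"]
    by linarith
  moreover have "size (branch_step v x a) \<le> size x + size (left a) + size (right (left (right a))) +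
      size (right (right a)) +
      size (extend ?e (left v)) + 4"
    by (simp add: branch_step_def)
  ultimately show ?thesis by linarith
qed

lemma size_branch:
  "size (branch v s st) \<le> size st + (2 + size s + size s * (size s + size v + 6))"
proof -
  have "size (fold (branch_step v) (elems s) (Node Leaf (Node s st)))
      \<le> size (Node Leaf (Node s st)) + (\<Sum>x\<leftarrow>elems s. size s + size v + 6)"
    by (rule size_fold_le) (use size_branch_step size_elems_le in \<open>fastforce intro: le_trans\<close>)
  moreover have "(\<Sum>x\<leftarrow>elems s. size s + size v + 6) \<le> size s * (size s + size v + 6)"
    using length_elems_le[of s] by (simp add: sum_list_triv mult_le_mono1 del: mult_Suc_right)
  ultimately show ?thesis
    unfolding branch_def
    using size_right[of "fold (branch_step v) (elems s) (Node Leaf (Node s st))"]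
      size_right[of "right (fold (branch_step v) (elems s) (Node Leaf (Node s st)))"]
    by simp
qed

lemma ptime_branch_step:
  assumes "ptime f" "ptime g" "ptime h"
  shows "ptime (\<lambda>v. branch_step (f v) (g v) (h v))"
  unfolding branch_step_def
  by (intro ptime_if ptime_pred_eq ptime_extend ptime_Node ptime_left ptime_right assms)

lemma ptime_branch:
  assumes "ptime f" "ptime g" "ptime h"
  shows "ptime (\<lambda>v. branch (f v) (g v) (h v))"
proof -
  have "ptime (\<lambda>v. fold (branch_step (f v)) (elems (g v)) (Node Leaf (Node (g v) (h v))))"
  proof (rule ptime_fold[where g = "\<lambda>v. branch_step (f v)"
        and r = "\<lambda>w. size w + size (f (left w)) + 6"])
    show "poly_bounded (\<lambda>w. size w + size (f (left w)) + 6)"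
      by (intro poly_bounded_add poly_bounded_size poly_bounded_const ptime_size
          ptime_comp[OF assms(1)] ptime_left ptime_id)
    show "size (branch_step (f e) x a)
        \<le> size a + (size (Node e x) + size (f (left (Node e x))) + 6)" for e x a
      using size_branch_step[of "f e" x a] by simp
  qed (intro ptime_branch_step ptime_comp[OF assms(1)] ptime_left ptime_right ptime_id
        ptime_Leaf ptime_Node assms)+
  then show ?thesis unfolding branch_def by (intro ptime_right)
qed

lemma ptime_branches:
  assumes "ptime f" "ptime g"
  shows "ptime (\<lambda>v. branches (f v) (g v))"
  unfolding branches_def
proof (rule ptime_fold[where g = "\<lambda>v. branch (f v)"
      and r = "\<lambda>w. 2 + size w + size w * (size w + size (f (left w)) + 6)"])
  show "poly_bounded (\<lambda>w. 2 + size w + size w * (size w + size (f (left w)) + 6))"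
    by (intro poly_bounded_add poly_bounded_mult poly_bounded_size poly_bounded_const ptime_size
        ptime_comp[OF assms(1)] ptime_left ptime_id)
  show "size (branch (f e) x a) \<le> size a + (2 + size (Node e x) +
      size (Node e x) * (size (Node e x) + size (f (left (Node e x))) + 6))" for e x a
    by (rule le_trans[OF size_branch]) (intro add_mono mult_le_mono, auto)
qed (intro ptime_branch ptime_comp[OF assms(1)] ptime_left ptime_right ptime_id assms)+

text \<open>Lists are compared as sets, so a second listing of a recorded set is dropped as well,
  whatever its order.\<close>

definition insert_minimal :: "tree \<Rightarrow> tree \<Rightarrow> tree" where
  "insert_minimal X R =
     (if \<exists>Z\<in>set (elems R). set (elems Z) \<subseteq> set (elems X) then R
      else Node X (fold (\<lambda>Z a. if set (elems X) \<subseteq> set (elems Z) then a else Node Z a) (elems R) Leaf))"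

lemma ptime_insert_minimal:
  assumes "ptime f" "ptime g"
  shows "ptime (\<lambda>v. insert_minimal (f v) (g v))"
  unfolding insert_minimal_def
proof (intro ptime_if ptime_pred_ex ptime_pred_subset ptime_Node assms
    ptime_comp[OF assms(1)] ptime_left ptime_right ptime_id)
  show "ptime (\<lambda>v. fold (\<lambda>Z a. if set (elems (f v)) \<subseteq> set (elems Z) then a else Node Z a)
      (elems (g v)) Leaf)"
    by (rule ptime_fold[where r = "\<lambda>w. size w"
          and g = "\<lambda>v Z a. if set (elems (f v)) \<subseteq> set (elems Z) then a else Node Z a"])
       (auto intro!: ptime_if ptime_pred_subset ptime_Node ptime_Leaf assms poly_bounded_size
          ptime_comp[OF assms(1)] ptime_left ptime_right ptime_id)
qed

text \<open>
  In \<open>Node r (Node st (Node R ss))\<close>, \<open>r\<close> is the result of decoding the top of the stack \<open>st\<close>.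
\<close>

definition search_step :: "tree \<Rightarrow> tree" where
  "search_step v =
     (if left v = Leaf
      then Node (right (left (right v))) (right (right v))
      else if \<forall>s\<in>set (elems (right (right (right v)))).
                \<exists>y\<in>set (elems s). y \<in> set (elems (left (left (right v))))
      then Node (right (left (right v)))
             (Node (insert_minimal (right (left v)) (left (right (right v))))
                (right (right (right v))))
      else Node (branches (Node (left (left (right v))) (right (right (right v))))
                   (right (left (right v))))
             (right (right v)))"

lemma ptime_search_step: "ptime search_step"
  unfolding search_step_def[abs_def]
  by (intro ptime_if ptime_pred_eq ptime_pred_all ptime_pred_ex ptime_pred_mem ptime_branches
      ptime_insert_minimal ptime_Node ptime_Leaf ptime_left ptime_right ptime_id)


section \<open>Slices of the coded families\<close>

lemma listset_iff: "xs \<in> listset As \<longleftrightarrow> length xs = length As \<and> (\<forall>i<length As. xs ! i \<in> As ! i)"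
proof -
  have "listset As = {xs. list_all2 (\<in>) xs As}"
    by (induction As) (auto simp: set_Cons_def list_all2_Cons2)
  then show ?thesis by (auto simp: list_all2_conv_all_nth)
qed

text \<open>Written with prefix and suffix because this is how \<open>branch_step\<close> traverses
  a tuple.\<close>

definition slice :: "'a list set \<Rightarrow> 'a list \<Rightarrow> nat \<Rightarrow> 'a set" where
  "slice S s p = {y. take p s @ y # drop (Suc p) s \<in> S}"

lemma slice_iff: "p < length s \<Longrightarrow> y \<in> slice S s p \<longleftrightarrow> s[p := y] \<in> S"
  by (simp add: slice_def upd_conv_take_nth_drop)

definition hits_all :: "'a list set \<Rightarrow> 'a set \<Rightarrow> bool" where
  "hits_all S Y \<longleftrightarrow> (\<forall>s\<in>S. \<exists>y\<in>set s. y \<in> Y)"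

locale coded_instance =
  fixes K k u q c :: nat and C :: "nat \<Rightarrow> nat set" and \<F> :: "nat \<Rightarrow> nat set set"
    and L :: "nat \<Rightarrow> nat set list" and S :: "nat list set"
  assumes binary: "binary_code u q C"
    and superimposed: "superimposed k u C"
    and witness_instance: "witness_instance K k u c \<F>"
    and listing: "\<forall>i\<in>{1..c}. listing K (\<F> i) (L i)"
    and S_def: "S = (\<Union>i\<in>{1..c}. code_tensor C (L i))"
begin

lemma code_mono: "X \<subseteq> Y \<Longrightarrow> code_of_set C X \<subseteq> code_of_set C Y"
  unfolding code_of_set_def by blast

lemma finite_sub: "X \<subseteq> {1..u} \<Longrightarrow> finite X"
  using finite_subset by blast

section \<open>Consequences of superimposition\<close>

lemma mem_of_code_subset:
  assumes "C y \<subseteq> code_of_set C W" "y \<in> {1..u}" "W \<subseteq> {1..u}" "card W \<le> k"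
  shows "y \<in> W"
  using superimposed[unfolded superimposed_def, rule_format, OF conjI[OF assms(3,4)], of y] assms(1,2)
  by blast

text \<open>Superimposition is applied to one element of \<open>Z\<close> at a time, so
  \<open>Z\<close> may be arbitrarily large, as is needed when \<open>Z\<close> is
  \<open>decoded Y\<close> for a union \<open>Y\<close> of slices.\<close>

lemma subset_of_code_subset:
  assumes "code_of_set C Z \<subseteq> code_of_set C W" "Z \<subseteq> {1..u}" "W \<subseteq> {1..u}" "card W \<le> k"
  shows "Z \<subseteq> W"
proof
  fix y assume y: "y \<in> Z"
  then have "C y \<subseteq> code_of_set C W" using assms(1) unfolding code_of_set_def by blast
  then show "y \<in> W" using mem_of_code_subset[OF _ _ assms(3,4)] y assms(2) by blast
qed

lemma mem_S_iff:
  "s \<in> S \<longleftrightarrow> (\<exists>i\<in>{1..c}. length s = K \<and> (\<forall>j<K. s ! j \<in> code_of_set C (L i ! j)))"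
proof -
  have "s \<in> code_tensor C (L i) \<longleftrightarrow> length s = K \<and> (\<forall>j<K. s ! j \<in> code_of_set C (L i ! j))"
    if "i \<in> {1..c}" for i
    using that listing by (auto simp: code_tensor_def listset_iff listing_def)
  then show ?thesis unfolding S_def by blast
qed

lemma nth_L: "i \<in> {1..c} \<Longrightarrow> j < K \<Longrightarrow> L i ! j \<in> \<F> i"
  using listing nth_mem unfolding listing_def by metis

lemma nth_L_subset: "i \<in> {1..c} \<Longrightarrow> j < K \<Longrightarrow> L i ! j \<subseteq> {1..u}"
  using nth_L witness_instance unfolding witness_instance_def by blast

lemma set_S_subset:
  assumes "s \<in> S"
  shows "length s = K" "set s \<subseteq> {1..q}"
proof -
  obtain i where i: "i \<in> {1..c}" "length s = K" "\<forall>j<K. s ! j \<in> code_of_set C (L i ! j)"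
    using assms mem_S_iff by blast
  have "code_of_set C (L i ! j) \<subseteq> {1..q}" if "j < K" for j
    using nth_L_subset[OF i(1) that] binary unfolding binary_code_def code_of_set_def by blast
  then show "length s = K" "set s \<subseteq> {1..q}"
    using i by (auto simp: set_conv_nth subset_iff)
qed

lemma card_S: "card S \<le> q ^ K"
proof -
  have sub: "S \<subseteq> {s. set s \<subseteq> {1..q} \<and> length s = K}" using set_S_subset by blast
  then show ?thesis
    using card_mono[OF _ sub] finite_lists_length_eq[of "{1..q}" K]
      card_lists_length_eq[of "{1..q}" K] by simp
qed

text \<open>
  If no \<open>F\<^sub>j\<close> lies in \<open>W\<close>, choose \<open>y \<in> F\<^sub>j - W\<close> for each \<open>j\<close>, and a position of \<open>C y\<close> outside
  \<open>C W\<close>; these form a tuple that \<open>C W\<close> does not hit.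
\<close>

lemma covers_iff_hits_all:
  assumes W: "W \<subseteq> {1..u}" "card W \<le> k"
  shows "covers c \<F> W \<longleftrightarrow> hits_all S (code_of_set C W)"
proof
  assume cov: "covers c \<F> W"
  show "hits_all S (code_of_set C W)"
    unfolding hits_all_def
  proof
    fix s assume "s \<in> S"
    then obtain i where i: "i \<in> {1..c}" "length s = K" "\<forall>j<K. s ! j \<in> code_of_set C (L i ! j)"
      using mem_S_iff by blast
    obtain A where "A \<in> \<F> i" "A \<subseteq> W" using cov i(1) unfolding covers_def by blast
    then obtain j where "j < K" "L i ! j \<subseteq> W"
      using listing i(1) by (metis listing_def in_set_conv_nth)
    then show "\<exists>y\<in>set s. y \<in> code_of_set C W" using i code_mono nth_mem by blast
  qed
next
  assume hit: "hits_all S (code_of_set C W)"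
  show "covers c \<F> W"
    unfolding covers_def
  proof (rule ballI, rule ccontr)
    fix i assume i: "i \<in> {1..c}" and none: "\<not> (\<exists>A\<in>\<F> i. A \<subseteq> W)"
    have "\<exists>z. z \<in> code_of_set C (L i ! j) - code_of_set C W" if j: "j < K" for j
    proof -
      obtain y where "y \<in> L i ! j" "y \<notin> W" using none nth_L[OF i j] by blast
      then show ?thesis
        using mem_of_code_subset[of y W] nth_L_subset[OF i j] W unfolding code_of_set_def by blast
    qed
    then obtain z where z: "\<And>j. j < K \<Longrightarrow> z j \<in> code_of_set C (L i ! j) - code_of_set C W" by metis
    have "map z [0..<K] \<in> S" unfolding mem_S_iff by (intro bexI[OF _ i]) (use z in auto)
    then show False using hit z unfolding hits_all_def by fastforce
  qed
qed

text \<open>In a product of sets, membership of \<open>s[p := y]\<close> splits into a condition on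
  the other coordinates, which selects the families in \<open>?I\<close>, and membership of
  \<open>y\<close> in the factor at \<open>p\<close>. Codes commute with unions, so the union of
  these factors is again a code.\<close>

lemma slice_eq_code:
  assumes "s \<in> S" "p < K"
  shows "\<exists>Z. Z \<subseteq> {1..u} \<and> slice S s p = code_of_set C Z"
proof -
  let ?I = "{i\<in>{1..c}. \<forall>j<K. j \<noteq> p \<longrightarrow> s ! j \<in> code_of_set C (L i ! j)}"
  have len: "length s = K" using assms set_S_subset(1) by blast
  have "(\<forall>j<K. s[p := y] ! j \<in> code_of_set C (L i ! j)) \<longleftrightarrow>
      (\<forall>j<K. j \<noteq> p \<longrightarrow> s ! j \<in> code_of_set C (L i ! j)) \<and> y \<in> code_of_set C (L i ! p)" for i y
    using len assms by (auto simp: nth_list_update)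
  then have "slice S s p = (\<Union>i\<in>?I. code_of_set C (L i ! p))"
    using len assms by (simp only: set_eq_iff slice_iff mem_S_iff length_list_update) blast
  also have "\<dots> = code_of_set C (\<Union>i\<in>?I. L i ! p)" unfolding code_of_set_def by blast
  finally show ?thesis using nth_L_subset assms by (intro exI[of _ "\<Union>i\<in>?I. L i ! p"]) blast
qed

text \<open>
  Minimality of \<open>W\<close> gives tuples that \<open>C (W - {x})\<close> does not hit. In such a tuple with the fewest
  positions in \<open>C W\<close>, changing one of these positions must leave it in \<open>C W\<close>.
\<close>

lemma solution_slice:
  assumes W: "W \<in> witness_supersets k u c \<F>" and x: "x \<in> W"
  obtains s p where "s \<in> S" "p < K" "C x \<subseteq> slice S s p" "slice S s p \<subseteq> code_of_set C W"
proof -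
  have Wu: "W \<subseteq> {1..u}" "card W \<le> k" "covers c \<F> W" "\<not> covers c \<F> (W - {x})"
    using W x unfolding witness_supersets_def by auto
  have Wx: "W - {x} \<subseteq> {1..u}" "card (W - {x}) \<le> k"
    using Wu card_Diff1_le[of W x] by auto
  define unhit where "unhit s \<longleftrightarrow> s \<in> S \<and> set s \<inter> code_of_set C (W - {x}) = {}" for s
  define hits where "hits s = card {j. j < K \<and> s ! j \<in> code_of_set C W}" for s
  have "\<exists>s. unhit s"
    using Wu(4) covers_iff_hits_all[OF Wx] unfolding hits_all_def unhit_def by blast
  then obtain s where s: "unhit s" and least: "\<And>t. unhit t \<Longrightarrow> hits s \<le> hits t"
    using ex_has_least_nat[of unhit _ hits] by blast
  have sS: "s \<in> S" "length s = K" using s set_S_subset(1) unfolding unhit_def by auto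
  \<comment> \<open>Since \<open>W\<close> covers, even the minimal tuple has a position in the code
    of \<open>W\<close>.\<close>
  obtain p where p: "p < K" "s ! p \<in> code_of_set C W"
    using Wu covers_iff_hits_all[OF Wu(1,2)] sS unfolding hits_all_def by (metis in_set_conv_nth)
  have sub: "slice S s p \<subseteq> code_of_set C W"
  proof (rule subsetI, rule ccontr)
    fix y assume y: "y \<in> slice S s p" "y \<notin> code_of_set C W"
    have "set (s[p := y]) \<subseteq> insert y (set s)" by (rule set_update_subset_insert)
    moreover have "y \<notin> code_of_set C (W - {x})" using y(2) code_mono[of "W - {x}" W] by blast
    moreover have "s[p := y] \<in> S" using y(1) p(1) sS(2) by (simp add: slice_iff)
    ultimately have "unhit (s[p := y])" using s unfolding unhit_def by blast
    moreover have "{j. j < K \<and> s[p := y] ! j \<in> code_of_set C W} \<subset>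
        {j. j < K \<and> s ! j \<in> code_of_set C W}"
      using p y(2) sS(2) by (auto simp: nth_list_update split: if_splits)
    then have "hits (s[p := y]) < hits s" unfolding hits_def by (intro psubset_card_mono) auto
    ultimately show False using least by fastforce
  qed
  obtain i where i: "i \<in> {1..c}" "\<forall>j<K. s ! j \<in> code_of_set C (L i ! j)"
    using sS mem_S_iff by blast
  \<comment> \<open>The other coordinates of \<open>s\<close> already lie in the product for family
    \<open>i\<close>, so any element of its factor at \<open>p\<close> may be substituted.\<close>
  have Fp: "code_of_set C (L i ! p) \<subseteq> slice S s p"
  proof
    fix y assume "y \<in> code_of_set C (L i ! p)"
    then have "s[p := y] \<in> S"
      unfolding mem_S_iff using i sS(2) p(1) by (intro bexI[OF _ i(1)]) (auto simp: nth_list_update)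
    then show "y \<in> slice S s p" using sS(2) p(1) by (simp add: slice_iff)
  qed
  then have FW: "L i ! p \<subseteq> W"
    by (rule subset_of_code_subset[OF subset_trans[OF _ sub] nth_L_subset[OF i(1) p(1)] Wu(1,2)])
  \<comment> \<open>As \<open>s\<close> is not hit by \<open>W - {x}\<close>, the entry
    \<open>s ! p\<close> is an element of the code of \<open>L i ! p\<close> that
    \<open>W - {x}\<close> cannot supply; so this member of the family must contain
    \<open>x\<close>.\<close>
  have "s ! p \<in> set s" using p(1) sS(2) by simp
  then have "s ! p \<notin> code_of_set C (W - {x})" using s unfolding unhit_def by blast
  moreover have "s ! p \<in> code_of_set C (L i ! p)" using i(2) p(1) by blast
  ultimately have "\<not> L i ! p \<subseteq> W - {x}" using code_mono by blast
  then have "x \<in> L i ! p" using FW by blast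
  then have "C x \<subseteq> slice S s p" using Fp unfolding code_of_set_def by blast
  then show thesis using that sS(1) p(1) sub by blast
qed

subsection \<open>Ranks of codes\<close>

text \<open>For a code \<open>Y\<close> this is the largest set with code \<open>Y\<close>; if it
  has at most \<open>k\<close> elements, it is the only one.\<close>

definition decoded :: "nat set \<Rightarrow> nat set" where
  "decoded Y = {x \<in> {1..u}. C x \<subseteq> Y}"

text \<open>By truncated subtraction the rank is 0 exactly for the codes that the decoder rejects,
  and positive for those that may be branched on.\<close>

definition rank :: "nat set \<Rightarrow> nat" where
  "rank Y = Suc k - card (decoded Y)"

text \<open>\<open>Z\<close> may have any size: a union of slices can be the code of a set too large
  to decode.\<close>

definition is_code :: "nat set \<Rightarrow> bool" where
  "is_code Y \<longleftrightarrow> (\<exists>Z\<subseteq>{1..u}. Y = code_of_set C Z)"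

lemma is_code_Un: "is_code Y \<Longrightarrow> is_code Z \<Longrightarrow> is_code (Y \<union> Z)"
  unfolding is_code_def code_of_set_def by (elim exE conjE, rule exI[of _ "_ \<union> _"]) blast

lemma is_code_slice: "s \<in> S \<Longrightarrow> p < K \<Longrightarrow> is_code (slice S s p)"
  using slice_eq_code unfolding is_code_def by blast

lemma is_code_subset: "is_code Y \<Longrightarrow> Y \<subseteq> {1..q}"
  using binary unfolding is_code_def code_of_set_def binary_code_def by blast

lemma code_decoded: "is_code Y \<Longrightarrow> code_of_set C (decoded Y) = Y"
  unfolding is_code_def decoded_def code_of_set_def by blast

lemma decoded_subset: "decoded Y \<subseteq> {1..u}"
  unfolding decoded_def by blast

lemma decoded_code:
  assumes "X \<subseteq> {1..u}" "card X \<le> k"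
  shows "decoded (code_of_set C X) = X"
  using assms mem_of_code_subset unfolding decoded_def code_of_set_def by blast

text \<open>\<open>decoded Y\<close> has code \<open>Y\<close>, and by superimposition every
  \<open>X\<close> of size at most \<open>k\<close> with that code equals it.\<close>

lemma decodable_iff:
  assumes "is_code Y"
  shows "(\<exists>X. X \<subseteq> {1..u} \<and> card X \<le> k \<and> code_of_set C X = Y) \<longleftrightarrow> card (decoded Y) \<le> k"
  using code_decoded[OF assms] decoded_subset[of Y] decoded_code by auto

text \<open>A code is the code of its decoding, so distinct codes have distinct decodings. This is
  the progress made by a branching.\<close>

lemma decoded_strict_mono:
  assumes "is_code Y" "is_code Y'" "Y \<subset> Y'"
  shows "card (decoded Y) < card (decoded Y')"
proof (rule psubset_card_mono)
  show "finite (decoded Y')" using finite_sub decoded_subset by blast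
  have "decoded Y \<subseteq> decoded Y'" using assms(3) unfolding decoded_def by blast
  moreover have "decoded Y \<noteq> decoded Y'" using assms code_decoded by (metis psubset_eq)
  ultimately show "decoded Y \<subset> decoded Y'" by blast
qed

lemma decoded_subset_solution:
  assumes "is_code Y" "Y \<subseteq> code_of_set C W" "W \<subseteq> {1..u}" "card W \<le> k"
  shows "decoded Y \<subseteq> W" "card (decoded Y) \<le> k"
proof -
  show sub: "decoded Y \<subseteq> W"
    by (rule subset_of_code_subset[OF _ decoded_subset assms(3,4)]) (simp add: assms code_decoded)
  show "card (decoded Y) \<le> k"
    using card_mono[OF finite_sub[OF assms(3)] sub] assms(4) by simp
qed

lemma minimal_solution_below:
  assumes "X \<subseteq> {1..u}" "card X \<le> k" "covers c \<F> X"
  obtains V where "V \<in> witness_supersets k u c \<F>" "V \<subseteq> X"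
proof -
  obtain V where V: "V \<subseteq> X" "covers c \<F> V"
    and least: "\<And>V'. V' \<subseteq> X \<Longrightarrow> covers c \<F> V' \<Longrightarrow> card V \<le> card V'"
    using ex_has_least_nat[of "\<lambda>V. V \<subseteq> X \<and> covers c \<F> V" X card] assms(3) by auto
  have fin: "finite X" using assms(1) finite_sub by blast
  have "card V \<le> k" using card_mono[OF fin V(1)] assms(2) by simp
  moreover have "\<not> covers c \<F> V'" if V': "V' \<subset> V" for V'
  proof
    assume "covers c \<F> V'"
    then have "card V \<le> card V'" using least V' V(1) by blast
    then show False using psubset_card_mono[OF finite_subset[OF V(1) fin] V'] by simp
  qed
  ultimately show thesis using that V assms(1) unfolding witness_supersets_def by blast
qed

end


section \<open>Correctness of the search step\<close>

abbreviation enc_nats :: "nat list \<Rightarrow> tree" where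
  "enc_nats \<equiv> enc_list enc_nat"

abbreviation enc_natss :: "nat list list \<Rightarrow> tree" where
  "enc_natss \<equiv> enc_list enc_nats"

lemma enc_nat_inject: "enc_nat m = enc_nat n \<Longrightarrow> m = n"
proof (induction m arbitrary: n rule: less_induct)
  case (less m)
  show ?case
  proof (cases "m = 0 \<or> n = 0")
    case True
    then show ?thesis using less.prems by (auto simp: enc_nat.simps[of m] enc_nat.simps[of n] split: if_splits)
  next
    case False
    then have "odd m = odd n" and "enc_nat (m div 2) = enc_nat (n div 2)"
      using less.prems by (auto simp: enc_nat.simps[of m] enc_nat.simps[of n] split: if_splits)
    moreover have "m div 2 = n div 2"
      using less.IH[of "m div 2" "n div 2"] False calculation by simp
    ultimately show ?thesis by (metis bit_eq_rec)
  qed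
qed

lemma inj_enc_nat: "inj enc_nat"
  using enc_nat_inject by (rule injI)

lemma inj_enc_list: "inj f \<Longrightarrow> inj (enc_list f)"
proof (rule injI)
  fix xs ys assume "inj f" "enc_list f xs = enc_list f ys"
  then have "map f xs = map f ys" by (metis elems_enc_list)
  then show "xs = ys" using \<open>inj f\<close> by (simp add: inj_map_eq_map)
qed

lemmas inj_enc = inj_enc_nat inj_enc_list[OF inj_enc_nat]

lemma enc_nats_eq_iff [simp]: "enc_nats xs = enc_nats ys \<longleftrightarrow> xs = ys"
  by (simp add: inj_eq inj_enc)

lemma rev_append_enc:
  "rev_append (enc_list f p) (enc_list f q) = enc_list f (rev p @ q)"
proof -
  have "fold Node (map f p) (enc_list f q) = enc_list f (rev p @ q)"
    by (induction p arbitrary: q) (simp_all flip: enc_list.simps)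
  then show ?thesis by (simp add: rev_append_def)
qed

section \<open>Extending a code by a slice\<close>

lemma extend_step_enc:
  "extend_step (Node (enc_natss S) (Node (enc_nats p) (enc_nats q))) (enc_nat y) (enc_nats Z) =
     enc_nats (if rev p @ y # q \<in> set S \<and> y \<notin> set Z then y # Z else Z)"
  using inj_image_mem_iff[OF inj_enc(1)] inj_image_mem_iff[OF inj_enc(2)]
  by (simp add: extend_step_def rev_append_enc flip: enc_list.simps(2))

lemma fold_extend_step_enc:
  fixes S :: "nat list list"
  defines "e \<equiv> \<lambda>p q. Node (enc_natss S) (Node (enc_nats p) (enc_nats q))"
  assumes "distinct Z"
  shows "\<exists>zs. fold (extend_step (e p q)) (map enc_nat s) (enc_nats Z) = enc_nats (zs @ Z) \<and>
    distinct (zs @ Z) \<and> set (zs @ Z) = set Z \<union> {y \<in> set s. rev p @ y # q \<in> set S}"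
  using assms(2)
proof (induction s arbitrary: Z)
  case Nil
  then show ?case by simp
next
  case (Cons y s)
  let ?Z = "if rev p @ y # q \<in> set S \<and> y \<notin> set Z then y # Z else Z"
  have "distinct ?Z" using Cons.prems by simp
  then obtain zs where zs: "fold (extend_step (e p q)) (map enc_nat s) (enc_nats ?Z) = enc_nats (zs @ ?Z)"
      "distinct (zs @ ?Z)" "set (zs @ ?Z) = set ?Z \<union> {y \<in> set s. rev p @ y # q \<in> set S}"
    using Cons.IH[of ?Z] by blast
  have "extend_step (e p q) (enc_nat y) (enc_nats Z) = enc_nats ?Z"
    unfolding e_def by (rule extend_step_enc)
  then show ?case
    using zs by (intro exI[of _ "zs @ (if rev p @ y # q \<in> set S \<and> y \<notin> set Z then [y] else [])"])
      (auto split: if_splits)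
qed

text \<open>Candidates are taken from \<open>T\<close> while membership is tested in the fixed
  \<open>S\<close>; the induction runs over \<open>T\<close>, and the two are identified
  afterwards.\<close>

lemma fold_fold_extend_step_enc:
  fixes S :: "nat list list"
  defines "e \<equiv> \<lambda>p q. Node (enc_natss S) (Node (enc_nats p) (enc_nats q))"
  assumes "distinct Z"
  shows "\<exists>zs. fold (\<lambda>s. fold (extend_step (e p q)) (elems s)) (map enc_nats T) (enc_nats Z) =
      enc_nats (zs @ Z) \<and> distinct (zs @ Z) \<and>
    set (zs @ Z) = set Z \<union> {y \<in> \<Union>(set ` set T). rev p @ y # q \<in> set S}"
  using assms(2)
proof (induction T arbitrary: Z)
  case Nil
  then show ?case by simp
next
  case (Cons t T)
  obtain zs where zs: "fold (extend_step (e p q)) (map enc_nat t) (enc_nats Z) = enc_nats (zs @ Z)"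
      "distinct (zs @ Z)" "set (zs @ Z) = set Z \<union> {y \<in> set t. rev p @ y # q \<in> set S}"
    using fold_extend_step_enc[OF Cons.prems] unfolding e_def by blast
  obtain zs' where zs': "fold (\<lambda>s. fold (extend_step (e p q)) (elems s)) (map enc_nats T)
        (enc_nats (zs @ Z)) = enc_nats (zs' @ zs @ Z)" "distinct (zs' @ zs @ Z)"
      "set (zs' @ zs @ Z) = set (zs @ Z) \<union> {y \<in> \<Union>(set ` set T). rev p @ y # q \<in> set S}"
    using Cons.IH[OF zs(2)] by blast
  have "set ((zs' @ zs) @ Z) = set Z \<union> {y \<in> \<Union>(set ` set (t # T)). rev p @ y # q \<in> set S}"
    using zs(3) zs'(3) by auto
  then show ?case using zs(1) zs'(1,2) by (intro exI[of _ "zs' @ zs"]) simp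
qed

text \<open>The last conjunct justifies the comparison of trees in \<open>branch_step\<close>:
  elements are only put in front, so an unchanged set means an unchanged list.\<close>

lemma extend_enc:
  assumes "distinct Y"
  shows "\<exists>Z. extend (Node (enc_natss S) (Node (enc_nats (rev (take p s))) (enc_nats (drop (Suc p) s))))
        (enc_nats Y) = enc_nats Z \<and>
    distinct Z \<and> set Z = set Y \<union> slice (set S) s p \<and> (set Z = set Y \<longrightarrow> Z = Y)"
proof -
  obtain zs where zs: "extend (Node (enc_natss S)
        (Node (enc_nats (rev (take p s))) (enc_nats (drop (Suc p) s)))) (enc_nats Y) = enc_nats (zs @ Y)"
      "distinct (zs @ Y)"
      "set (zs @ Y) = set Y \<union> {y \<in> \<Union>(set ` set S). rev (rev (take p s)) @ y # drop (Suc p) s \<in> set S}"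
    using fold_fold_extend_step_enc[OF assms, of S "rev (take p s)" "drop (Suc p) s" S]
    unfolding extend_def by auto
  \<comment> \<open>Every element of a slice is itself an entry of some tuple of \<open>S\<close>,
    so trying only such entries loses nothing.\<close>
  have "set (zs @ Y) = set Y \<union> slice (set S) s p"
    unfolding zs(3) by (force simp: slice_def)
  moreover have "set (zs @ Y) = set Y \<longrightarrow> zs @ Y = Y"
    using zs(2) by (cases zs) auto
  ultimately show ?thesis using zs(1,2) by blast
qed

text \<open>\<open>I\<close> collects the pairs of tuple and position treated so far. Only the sets
  of children are prescribed, since different slices may give the same child; \<open>set Y\<close>
  is excluded because it would make no progress.\<close>

definition branching :: "nat list list \<Rightarrow> nat list \<Rightarrow> (nat list \<times> nat) set \<Rightarrow> nat list list \<Rightarrow> bool" where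
  "branching S Y I cs \<longleftrightarrow> (\<forall>c\<in>set cs. distinct c) \<and>
     set ` set cs = (\<lambda>(s, p). set Y \<union> slice (set S) s p) ` I - {set Y}"

lemma branching_Un:
  "branching S Y I cs \<Longrightarrow> branching S Y J ds \<Longrightarrow> branching S Y (I \<union> J) (cs @ ds)"
  unfolding branching_def by (auto simp: image_Un)

text \<open>The tuple \<open>rev pre @ r\<close> stays fixed while the boundary moves through it, so
  \<open>length pre\<close> is the current position.\<close>

lemma fold_branch_step_enc:
  assumes "distinct Y"
  shows "\<exists>cs. right (right (fold (branch_step (Node (enc_nats Y) (enc_natss S))) (map enc_nat r)
      (Node (enc_nats pre) (Node (enc_nats r) (enc_natss st))))) = enc_natss (cs @ st) \<and>
    length cs \<le> length r \<and>
    branching S Y ({rev pre @ r} \<times> {length pre..<length pre + length r}) cs"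
proof (induction r arbitrary: pre st)
  case Nil
  show ?case by (intro exI[of _ "[]"]) (simp add: branching_def)
next
  case (Cons x r)
  let ?s = "rev pre @ x # r" and ?p = "length pre"
  have s: "rev (take ?p ?s) = pre" "drop (Suc ?p) ?s = r" by simp_all
  obtain Z where Z: "extend (Node (enc_natss S) (Node (enc_nats pre) (enc_nats r))) (enc_nats Y) =
        enc_nats Z" "distinct Z" "set Z = set Y \<union> slice (set S) ?s ?p" "set Z = set Y \<longrightarrow> Z = Y"
    using extend_enc[OF assms, of S ?p ?s] unfolding s by blast
  let ?z = "if Z = Y then [] else [Z]"
  have b: "branching S Y {(?s, ?p)} ?z"
    using Z by (auto simp: branching_def)
  have step: "branch_step (Node (enc_nats Y) (enc_natss S)) (enc_nat x)
      (Node (enc_nats pre) (Node (enc_nats (x # r)) (enc_natss st))) =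
    Node (enc_nats (x # pre)) (Node (enc_nats r) (enc_natss (?z @ st)))"
    by (simp add: branch_step_def Z(1))
  obtain cs where cs: "right (right (fold (branch_step (Node (enc_nats Y) (enc_natss S))) (map enc_nat r)
      (Node (enc_nats (x # pre)) (Node (enc_nats r) (enc_natss (?z @ st)))))) = enc_natss (cs @ ?z @ st)"
    "length cs \<le> length r"
    "branching S Y ({?s} \<times> {Suc ?p..<Suc ?p + length r}) cs"
    using Cons.IH[of "x # pre" "?z @ st"] by auto
  have "{?s} \<times> {Suc ?p..<Suc ?p + length r} \<union> {(?s, ?p)} = {?s} \<times> {?p..<?p + length (x # r)}"
    by auto
  then have "branching S Y ({?s} \<times> {?p..<?p + length (x # r)}) (cs @ ?z)"
    using branching_Un[OF cs(3) b] by simp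
  moreover have "length (cs @ ?z) \<le> length (x # r)" using cs(2) by simp
  ultimately show ?case
    using cs(1) step by (intro exI[of _ "cs @ ?z"]) (simp only: list.map fold_simps append_assoc)
qed

lemma branch_enc:
  assumes "distinct Y"
  obtains cs where "branch (Node (enc_nats Y) (enc_natss S)) (enc_nats s) (enc_natss st) =
      enc_natss (cs @ st)" "length cs \<le> length s" "branching S Y ({s} \<times> {..<length s}) cs"
  using fold_branch_step_enc[OF assms, of S s "[]" st]
  by (auto simp: branch_def atLeast0LessThan)

lemma fold_branch_enc:
  assumes "distinct Y" "\<forall>s\<in>set T. length s = K"
  shows "\<exists>cs. fold (branch (Node (enc_nats Y) (enc_natss S))) (map enc_nats T) (enc_natss st) =
      enc_natss (cs @ st) \<and> length cs \<le> length T * K \<and> branching S Y (set T \<times> {..<K}) cs"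
  using assms(2)
proof (induction T arbitrary: st)
  case Nil
  show ?case by (intro exI[of _ "[]"]) (simp add: branching_def)
next
  case (Cons s T)
  have s: "length s = K" using Cons.prems by simp
  obtain cs where cs: "branch (Node (enc_nats Y) (enc_natss S)) (enc_nats s) (enc_natss st) =
      enc_natss (cs @ st)" "length cs \<le> K" "branching S Y ({s} \<times> {..<K}) cs"
    using branch_enc[OF assms(1), of S s st] unfolding s by blast
  obtain ds where ds: "fold (branch (Node (enc_nats Y) (enc_natss S))) (map enc_nats T)
      (enc_natss (cs @ st)) = enc_natss (ds @ cs @ st)" "length ds \<le> length T * K"
      "branching S Y (set T \<times> {..<K}) ds"
    using Cons.IH[of "cs @ st"] Cons.prems by auto
  have "set T \<times> {..<K} \<union> {s} \<times> {..<K} = set (s # T) \<times> {..<K}" by auto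
  then have "branching S Y (set (s # T) \<times> {..<K}) (ds @ cs)"
    using branching_Un[OF ds(3) cs(3)] by simp
  then show ?case using cs ds by (intro exI[of _ "ds @ cs"]) auto
qed

lemma branches_enc:
  assumes "distinct Y" "\<forall>s\<in>set S. length s = K"
  obtains cs where "branches (Node (enc_nats Y) (enc_natss S)) (enc_natss st) = enc_natss (cs @ st)"
    "length cs \<le> length S * K" "branching S Y (set S \<times> {..<K}) cs"
  using fold_branch_enc[OF assms, of S st] by (auto simp: branches_def)

text \<open>The \<open>rev\<close> reflects that the fold in \<open>insert_minimal\<close> rebuilds
  the list from the front.\<close>

definition insert_antichain :: "nat list \<Rightarrow> nat list list \<Rightarrow> nat list list" where
  "insert_antichain X R =
     (if \<exists>Z\<in>set R. set Z \<subseteq> set X then R else X # rev (filter (\<lambda>Z. \<not> set X \<subseteq> set Z) R))"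

lemma insert_minimal_enc:
  "insert_minimal (enc_nats X) (enc_natss R) = enc_natss (insert_antichain X R)"
proof -
  have sub: "set (elems (enc_nats A)) \<subseteq> set (elems (enc_nats B)) \<longleftrightarrow> set A \<subseteq> set B" for A B
    by (simp add: inj_image_subset_iff inj_enc)
  have "fold (\<lambda>Z a. if set (elems (enc_nats X)) \<subseteq> set (elems Z) then a else Node Z a) (map enc_nats R)
      (enc_natss T) = enc_natss (rev (filter (\<lambda>Z. \<not> set X \<subseteq> set Z) R) @ T)" for T
    by (induction R arbitrary: T) (simp_all add: sub del: elems_enc_list flip: enc_list.simps(2))
  from this[of "[]"] show ?thesis
    by (auto simp: insert_minimal_def insert_antichain_def inj_image_subset_iff inj_enc)
qed


section \<open>The search\<close>

text \<open>Each bit costs a spine node and, if it is 1, one more node.\<close>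

lemma size_enc_nat: "n < 2 ^ m \<Longrightarrow> size (enc_nat n) \<le> 2 * m"
proof (induction m arbitrary: n)
  case 0
  then show ?case by (simp add: enc_nat.simps[of 0])
next
  case (Suc m)
  then have "size (enc_nat (n div 2)) \<le> 2 * m" by (intro Suc.IH) auto
  then show ?case by (simp add: enc_nat.simps[of n])
qed

lemma size_enc_list:
  assumes "\<forall>x\<in>set xs. size (f x) \<le> B" "length xs \<le> n"
  shows "size (enc_list f xs) \<le> n * (B + 1)"
proof -
  have "size (enc_list f xs) \<le> length xs * (B + 1)"
    using assms(1) by (induction xs) auto
  then show ?thesis using mult_le_mono1[OF assms(2), of "B + 1"] by linarith
qed

definition search_loop :: "com \<Rightarrow> com \<Rightarrow> com" where
  "search_loop D P = While (Left (Var 2))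
     (Seq (Call 3 D (Pair (Var 5) (Left (Left (Var 2))))) (Call 2 P (Pair (Var 3) (Var 2))))"

text \<open>\<open>Pair Empty Empty\<close> is the stack whose only entry is the empty code; the
  following \<open>Empty\<close> is the empty list of results.\<close>

definition search_com :: "com \<Rightarrow> com \<Rightarrow> com" where
  "search_com D P =
     Seq (Assign 5 (Left (Var 0)))
    (Seq (Assign 2 (Pair (Pair Empty Empty) (Pair Empty (Right (Var 0)))))
    (Seq (search_loop D P)
    (Assign 0 (Left (Right (Var 2))))))"

abbreviation antichain :: "nat list list \<Rightarrow> bool" where
  "antichain \<equiv> sorted_wrt (\<lambda>X Z. \<not> set X \<subseteq> set Z \<and> \<not> set Z \<subseteq> set X)"

section \<open>Antichains of covers\<close>

lemma antichain_insert: "antichain R \<Longrightarrow> antichain (insert_antichain X R)"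
  by (auto simp: insert_antichain_def sorted_wrt_rev conj_commute intro: sorted_wrt_filter)

lemma set_insert_antichain: "set (insert_antichain X R) \<subseteq> insert X (set R)"
  by (auto simp: insert_antichain_def)

lemma length_insert_antichain: "length (insert_antichain X R) \<le> Suc (length R)"
  by (simp add: insert_antichain_def)

lemma antichain_distinct: "antichain R \<Longrightarrow> distinct (map set R)"
  by (induction R) auto

lemma antichain_subset:
  "antichain R \<Longrightarrow> X \<in> set R \<Longrightarrow> Z \<in> set R \<Longrightarrow> set X \<subseteq> set Z \<Longrightarrow> X = Z"
  by (induction R) auto

locale search_instance = coded_instance +
  fixes D :: com and desc :: tree and T :: real and ss :: "nat list list"
  assumes decodes: "decodes D desc k u q C T" and lists_S: "lists_set ss S"
begin

lemma ss: "distinct ss" "set ss = S" "length ss = card S" "\<forall>s\<in>set ss. length s = K"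
  using lists_S set_S_subset(1) by (auto simp: lists_set_def distinct_card)

text \<open>At most one child arises for each tuple and position.\<close>

definition N :: nat where "N = card S * K"

text \<open>With base \<open>N + 1\<close>, a code outweighs \<open>N\<close> codes of smaller rank
  by at least one, which pays for the iteration that expands it.\<close>

definition weight :: "nat list \<Rightarrow> nat" where "weight Y = (N + 1) ^ rank (set Y)"

definition potential :: "nat list list \<Rightarrow> nat" where
  "potential st = (\<Sum>Y\<leftarrow>st. weight Y)"

text \<open>Every solution is recorded or still reachable from a stacked code below its own code.
  Recorded sets need only be covers; that they are minimal emerges when the stack is empty. A result
  is paid for by the weight of the code it came from, so one inequality bounds both lists.\<close>

definition invariant :: "nat list list \<Rightarrow> nat list list \<Rightarrow> bool" where
  "invariant st R \<longleftrightarrow>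
     (\<forall>Y\<in>set st. distinct Y \<and> is_code (set Y)) \<and>
     (\<forall>X\<in>set R. distinct X \<and> set X \<subseteq> {1..u} \<and> card (set X) \<le> k \<and> covers c \<F> (set X)) \<and>
     antichain R \<and>
     (\<forall>W\<in>witness_supersets k u c \<F>.
        W \<in> set ` set R \<or> (\<exists>Y\<in>set st. set Y \<subseteq> code_of_set C W)) \<and>
     length R + potential st \<le> (N + 1) ^ (k + 1)"

definition decoding :: "nat list \<Rightarrow> nat list option \<Rightarrow> bool" where
  "decoding Y r \<longleftrightarrow>
     (if card (decoded (set Y)) \<le> k then \<exists>xs. r = Some xs \<and> distinct xs \<and> set xs = decoded (set Y)
      else r = None)"

definition enc_state :: "nat list list \<Rightarrow> nat list list \<Rightarrow> tree" where
  "enc_state st R = Node (enc_natss st) (Node (enc_natss R) (enc_natss ss))"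

lemma decoder_exec:
  assumes "distinct Y" "is_code (set Y)"
  obtains t r where "runs D (Node desc (enc_nats Y)) t (enc_option enc_nats r)" "real t \<le> T"
    "decoding Y r"
proof -
  have "set Y \<subseteq> {1..q} \<and> lists_set Y (set Y)"
    using is_code_subset[OF assms(2)] assms(1) by (simp add: lists_set_def)
  from decodes[unfolded decodes_def, rule_format, OF this]
  obtain t r where r: "runs D (Node desc (enc_nats Y)) t (enc_option enc_nats r)" "real t \<le> T"
    "case r of
       Some xs \<Rightarrow> \<exists>X. lists_set xs X \<and> X \<subseteq> {1..u} \<and> card X \<le> k \<and> code_of_set C X = set Y
     | None \<Rightarrow> \<not> (\<exists>X. X \<subseteq> {1..u} \<and> card X \<le> k \<and> code_of_set C X = set Y)"
    by blast
  have "decoding Y r"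
  proof (cases r)
    case None
    then have "\<not> card (decoded (set Y)) \<le> k"
      using r(3) unfolding decodable_iff[OF assms(2), symmetric] by simp
    then show ?thesis using None by (simp add: decoding_def)
  next
    case (Some xs)
    then have xs: "distinct xs" "set xs \<subseteq> {1..u}" "card (set xs) \<le> k"
        "code_of_set C (set xs) = set Y"
      using r(3) by (auto simp: lists_set_def)
    then have "set xs = decoded (set Y)" using decoded_code by metis
    then show ?thesis using xs Some by (simp add: decoding_def)
  qed
  then show thesis using that r by blast
qed

section \<open>The three outcomes of an iteration\<close>

lemma hits_all_iff_covers:
  assumes "is_code (set Y)" "card (decoded (set Y)) \<le> k"
  shows "hits_all (set ss) (set Y) \<longleftrightarrow> covers c \<F> (decoded (set Y))"
  using covers_iff_hits_all[OF decoded_subset assms(2)] code_decoded[OF assms(1)]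
  by (simp add: ss)

lemma solutionD:
  assumes "W \<in> witness_supersets k u c \<F>"
  shows "W \<subseteq> {1..u}" "card W \<le> k" "covers c \<F> W" "covers c \<F> V \<Longrightarrow> V \<subseteq> W \<Longrightarrow> V = W"
  using assms unfolding witness_supersets_def by auto

lemma weight_pos: "weight Y > 0"
  by (simp add: weight_def)

lemma potential_Cons: "potential (Y # st) = weight Y + potential st"
  by (simp add: potential_def)

text \<open>A code below that of a solution decodes to a subset of the solution, so a rejected code
  leads to none.\<close>

lemma invariant_skip:
  assumes inv: "invariant (Y # st) R" and large: "\<not> card (decoded (set Y)) \<le> k"
  shows "invariant st R"
proof -
  have "is_code (set Y)" using inv unfolding invariant_def by simp
  then have "\<not> set Y \<subseteq> code_of_set C W" if "W \<in> witness_supersets k u c \<F>" for W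
    using decoded_subset_solution(2)[of "set Y" W] solutionD[OF that] large by blast
  then show ?thesis using inv unfolding invariant_def potential_Cons by auto
qed

text \<open>A cover contained in a solution equals it. Hence a popped code below the code of
  \<open>W\<close> decodes to \<open>W\<close> itself, and neither dropping nor evicting in
  \<open>insert_antichain\<close> can lose a solution.\<close>

lemma invariant_insert:
  assumes inv: "invariant (Y # st) R"
    and xs: "distinct xs" "set xs = decoded (set Y)" "card (decoded (set Y)) \<le> k"
    and hit: "hits_all (set ss) (set Y)"
  shows "invariant st (insert_antichain xs R)"
proof -
  have Y: "is_code (set Y)" using inv unfolding invariant_def by simp
  have cov: "covers c \<F> (set xs)" using hits_all_iff_covers[OF Y xs(3)] hit xs(2) by simp
  have R: "\<forall>X\<in>set R. covers c \<F> (set X)" using inv unfolding invariant_def by blast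
  have sol: "W \<in> set ` set (insert_antichain xs R) \<or> (\<exists>Y\<in>set st. set Y \<subseteq> code_of_set C W)"
    if W: "W \<in> witness_supersets k u c \<F>" for W
  proof -
    have "W \<in> set ` set R \<or> set Y \<subseteq> code_of_set C W \<or> (\<exists>Y\<in>set st. set Y \<subseteq> code_of_set C W)"
      using inv W unfolding invariant_def by auto
    moreover have "W \<in> set ` set (insert_antichain xs R)" if "set Y \<subseteq> code_of_set C W"
    proof -
      have "set xs \<subseteq> W"
        using decoded_subset_solution(1)[OF Y that] solutionD[OF W] xs(2) by blast
      then have eq: "set xs = W" using solutionD(4)[OF W cov] by blast
      then show ?thesis
        using solutionD(4)[OF W] R unfolding insert_antichain_def by (auto simp: image_iff)
    qed
    moreover have "W \<in> set ` set (insert_antichain xs R)" if WR: "W \<in> set ` set R"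
    proof -
      obtain Z where Z: "Z \<in> set R" "W = set Z" using WR by blast
      have "set xs \<subseteq> set Z \<Longrightarrow> set xs = set Z" using solutionD(4)[OF W cov] Z(2) by blast
      then show ?thesis using Z unfolding insert_antichain_def by auto
    qed
    ultimately show ?thesis by blast
  qed
  have "length (insert_antichain xs R) + potential st \<le> length R + potential (Y # st)"
    using length_insert_antichain[of xs R] weight_pos[of Y] by (simp add: potential_Cons)
  then have "length (insert_antichain xs R) + potential st \<le> (N + 1) ^ (k + 1)"
    using inv unfolding invariant_def by linarith
  moreover have "\<forall>X\<in>set (insert_antichain xs R).
      distinct X \<and> set X \<subseteq> {1..u} \<and> card (set X) \<le> k \<and> covers c \<F> (set X)"
  proof
    fix X assume "X \<in> set (insert_antichain xs R)"
    then have "X = xs \<or> X \<in> set R" using set_insert_antichain by blast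
    then show "distinct X \<and> set X \<subseteq> {1..u} \<and> card (set X) \<le> k \<and> covers c \<F> (set X)"
      using inv cov xs decoded_subset unfolding invariant_def by metis
  qed
  ultimately show ?thesis
    unfolding invariant_def
    by (intro conjI ballI sol antichain_insert) (use inv in \<open>simp_all add: invariant_def\<close>)
qed

lemma potential_branching:
  assumes Y: "is_code (set Y)" "card (decoded (set Y)) \<le> k"
    and cs: "length cs \<le> N" "branching ss Y (S \<times> {..<K}) cs"
  shows "potential cs < weight Y" "\<forall>Z\<in>set cs. distinct Z \<and> is_code (set Z)"
proof -
  have Z: "distinct Z \<and> is_code (set Z) \<and> set Y \<subset> set Z" if "Z \<in> set cs" for Z
  proof -
    have "set Z \<in> (\<lambda>(s, p). set Y \<union> slice S s p) ` (S \<times> {..<K}) - {set Y}" "distinct Z"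
      using cs(2) that unfolding branching_def ss(2) by blast+
    moreover from this obtain s p where "s \<in> S" "p < K" "set Z = set Y \<union> slice S s p" by auto
    ultimately show ?thesis using is_code_Un[OF Y(1) is_code_slice] by auto
  qed
  \<comment> \<open>\<open>Y\<close> is decodable, so its rank is positive; the children are
    strictly larger codes and have rank at most \<open>m\<close>.\<close>
  obtain m where m: "rank (set Y) = Suc m" using Y(2) by (cases "rank (set Y)") (auto simp: rank_def)
  have "weight Z \<le> (N + 1) ^ m" if "Z \<in> set cs" for Z
  proof -
    have "rank (set Z) \<le> m"
      using decoded_strict_mono[OF Y(1), of "set Z"] Z[OF that] m unfolding rank_def by force
    then show ?thesis unfolding weight_def by (intro power_increasing) auto
  qed
  then have "potential cs \<le> (\<Sum>Z\<leftarrow>cs. (N + 1) ^ m)"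
    unfolding potential_def by (intro sum_list_mono)
  also have "\<dots> = length cs * (N + 1) ^ m" by (simp add: sum_list_triv)
  also have "\<dots> \<le> N * (N + 1) ^ m" using cs(1) by (intro mult_le_mono1)
  also have "\<dots> < weight Y" by (simp add: weight_def m)
  finally show "potential cs < weight Y" .
  show "\<forall>Z\<in>set cs. distinct Z \<and> is_code (set Z)" using Z by blast
qed

text \<open>\<open>decoded (set Y)\<close> lies in \<open>W\<close> but does not cover, so it misses
  some \<open>x\<close> of \<open>W\<close>. The slice that \<open>solution_slice\<close> provides
  for \<open>x\<close> adds something new, as it contains \<open>C x\<close>, and the resulting
  child stays below the code of \<open>W\<close>.\<close>

lemma invariant_branch:
  assumes inv: "invariant (Y # st) R" and small: "card (decoded (set Y)) \<le> k"
    and not_hit: "\<not> hits_all (set ss) (set Y)"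
    and cs: "length cs \<le> N" "branching ss Y (S \<times> {..<K}) cs"
  shows "invariant (cs @ st) R"
proof -
  have Y: "is_code (set Y)" using inv unfolding invariant_def by simp
  note pot = potential_branching[OF Y small cs]
  have "\<exists>Z\<in>set cs. set Z \<subseteq> code_of_set C W"
    if W: "W \<in> witness_supersets k u c \<F>" and YW: "set Y \<subseteq> code_of_set C W" for W
  proof -
    have "decoded (set Y) \<subseteq> W" using decoded_subset_solution(1)[OF Y YW] solutionD[OF W] by blast
    moreover have "decoded (set Y) \<noteq> W"
      using hits_all_iff_covers[OF Y small] not_hit solutionD(3)[OF W] by blast
    ultimately obtain x where x: "x \<in> W" "x \<notin> decoded (set Y)" by blast
    obtain s p where sp: "s \<in> S" "p < K" "C x \<subseteq> slice S s p" "slice S s p \<subseteq> code_of_set C W"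
      using solution_slice[OF W x(1)] .
    have "\<not> C x \<subseteq> set Y" using x solutionD(1)[OF W] unfolding decoded_def by blast
    then have "set Y \<union> slice S s p \<in> (\<lambda>(s, p). set Y \<union> slice S s p) ` (S \<times> {..<K}) - {set Y}"
      using sp by auto
    then have "set Y \<union> slice S s p \<in> set ` set cs" using cs(2) unfolding branching_def ss(2) by blast
    then show ?thesis using YW sp(4) by auto
  qed
  then have "\<forall>W\<in>witness_supersets k u c \<F>.
      W \<in> set ` set R \<or> (\<exists>Z\<in>set (cs @ st). set Z \<subseteq> code_of_set C W)"
    using inv unfolding invariant_def by (metis Un_iff set_ConsD set_append)
  moreover have "potential (cs @ st) \<le> potential (Y # st)"
    using pot(1) by (simp add: potential_def)
  then have "length R + potential (cs @ st) \<le> (N + 1) ^ (k + 1)"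
    using inv unfolding invariant_def by linarith
  moreover have "\<forall>Z\<in>set (cs @ st). distinct Z \<and> is_code (set Z)"
    using inv pot(2) unfolding invariant_def by auto
  ultimately show ?thesis using inv unfolding invariant_def by blast
qed

lemma search_step_enc:
  assumes inv: "invariant (Y # st) R" and r: "decoding Y r"
  obtains st' R' where
    "search_step (Node (enc_option enc_nats r) (enc_state (Y # st) R)) = enc_state st' R'"
    "invariant st' R'" "potential st' < potential (Y # st)"
proof (cases "card (decoded (set Y)) \<le> k")
  case False
  then have "search_step (Node (enc_option enc_nats r) (enc_state (Y # st) R)) = enc_state st R"
    using r by (simp add: decoding_def search_step_def enc_state_def)
  then show thesis
    using that invariant_skip[OF inv False] weight_pos[of Y] by (simp add: potential_Cons)
next
  case small: True
  then obtain xs where xs: "r = Some xs" "distinct xs" "set xs = decoded (set Y)"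
    using r by (auto simp: decoding_def)
  have Y: "distinct Y" "is_code (set Y)" using inv by (auto simp: invariant_def)
  show thesis
  proof (cases "hits_all (set ss) (set Y)")
    case True
    then have "search_step (Node (enc_option enc_nats r) (enc_state (Y # st) R)) =
        enc_state st (insert_antichain xs R)"
      by (auto simp: xs(1) search_step_def enc_state_def inj_image_mem_iff inj_enc hits_all_def
          insert_minimal_enc)
    then show thesis
      using that invariant_insert[OF inv xs(2,3) small True] weight_pos[of Y]
      by (simp add: potential_Cons)
  next
    case False
    obtain cs where cs: "branches (Node (enc_nats Y) (enc_natss ss)) (enc_natss st) =
        enc_natss (cs @ st)" "length cs \<le> N" "branching ss Y (S \<times> {..<K}) cs"
      using branches_enc[OF Y(1) ss(4)] unfolding ss(2,3) N_def by blast
    have "search_step (Node (enc_option enc_nats r) (enc_state (Y # st) R)) = enc_state (cs @ st) R"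
      using False cs(1)
      by (auto simp: xs(1) search_step_def enc_state_def inj_image_mem_iff inj_enc hits_all_def)
    then show thesis
      using that invariant_branch[OF inv small False cs(2,3)]
        potential_branching(1)[OF Y(2) small cs(2,3)]
      by (simp add: potential_def)
  qed
qed

text \<open>The summands bound the stack, the results, the tuples and the decoder's answer. Numbers
  up to \<open>q\<close> are generously given \<open>q\<close> bits, those up to \<open>u\<close>
  get \<open>m\<close> bits; the 4 counts the nodes joining the components.\<close>

definition size_bound :: "nat \<Rightarrow> nat" where
  "size_bound m = (N + 1) ^ (k + 1) * (q * (2 * q + 1) + 1) +
     (N + 1) ^ (k + 1) * (k * (2 * m + 1) + 1) +
     card S * (K * (2 * q + 1) + 1) + k * (2 * m + 1) + 4"

lemma size_enc_nats_code:
  assumes "set Y \<subseteq> {1..q}" "length Y \<le> n"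
  shows "size (enc_nats Y) \<le> n * (2 * q + 1)"
proof (rule size_enc_list[OF _ assms(2)], rule ballI)
  fix y assume "y \<in> set Y"
  then have "y < 2 ^ q" using assms(1) less_exp[of q] by (meson atLeastAtMost_iff le_less_trans subsetD)
  then show "size (enc_nat y) \<le> 2 * q" by (rule size_enc_nat)
qed

lemma size_enc_nats_word:
  assumes "set X \<subseteq> {1..u}" "length X \<le> n" "u < 2 ^ m"
  shows "size (enc_nats X) \<le> n * (2 * m + 1)"
proof (rule size_enc_list[OF _ assms(2)], rule ballI)
  fix y assume "y \<in> set X"
  then have "y < 2 ^ m" using assms(1,3) by (meson atLeastAtMost_iff le_less_trans subsetD)
  then show "size (enc_nat y) \<le> 2 * m" by (rule size_enc_nat)
qed

lemma length_le_potential: "length st \<le> potential st"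
proof (induction st)
  case (Cons Y st)
  then show ?case using weight_pos[of Y] by (simp add: potential_Cons)
qed (simp add: potential_def)

lemma invariantD:
  assumes "invariant st R"
  shows "Y \<in> set st \<Longrightarrow> distinct Y" "Y \<in> set st \<Longrightarrow> is_code (set Y)"
    and "X \<in> set R \<Longrightarrow> distinct X" "X \<in> set R \<Longrightarrow> set X \<subseteq> {1..u}"
    and "X \<in> set R \<Longrightarrow> card (set X) \<le> k"
    and "length R + potential st \<le> (N + 1) ^ (k + 1)"
  using assms by (simp_all add: invariant_def)

lemma size_state:
  assumes inv: "invariant (Y # st) R" and r: "decoding Y r" and m: "u < 2 ^ m"
  shows "size (Node (enc_option enc_nats r) (enc_state (Y # st) R)) \<le> size_bound m"
proof -
  have len: "length (Y # st) \<le> (N + 1) ^ (k + 1)" "length R \<le> (N + 1) ^ (k + 1)"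
    using invariantD(6)[OF inv] length_le_potential[of "Y # st"] by linarith+
  have "\<forall>Z\<in>set (Y # st). size (enc_nats Z) \<le> q * (2 * q + 1)"
  proof
    fix Z assume "Z \<in> set (Y # st)"
    note Z = invariantD(1)[OF inv this] is_code_subset[OF invariantD(2)[OF inv this]]
    have "length Z \<le> q" using card_mono[OF _ Z(2)] distinct_card[OF Z(1)] by simp
    then show "size (enc_nats Z) \<le> q * (2 * q + 1)" by (rule size_enc_nats_code[OF Z(2)])
  qed
  note stack = size_enc_list[OF this len(1)]
  have "\<forall>X\<in>set R. size (enc_nats X) \<le> k * (2 * m + 1)"
  proof
    fix X assume "X \<in> set R"
    note X = invariantD(3-5)[OF inv this]
    have "length X \<le> k" using X(3) distinct_card[OF X(1)] by simp
    then show "size (enc_nats X) \<le> k * (2 * m + 1)" by (rule size_enc_nats_word[OF X(2) _ m])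
  qed
  note results = size_enc_list[OF this len(2)]
  have "\<forall>s\<in>set ss. size (enc_nats s) \<le> K * (2 * q + 1)"
  proof
    fix s assume "s \<in> set ss"
    then have s: "set s \<subseteq> {1..q}" "length s \<le> K" using set_S_subset ss(2) by auto
    then show "size (enc_nats s) \<le> K * (2 * q + 1)" by (rule size_enc_nats_code)
  qed
  note tuples = size_enc_list[OF this eq_refl[OF ss(3)]]
  have decoded: "size (enc_option enc_nats r) \<le> k * (2 * m + 1) + 1"
  proof (cases r)
    case (Some xs)
    then have xs: "distinct xs" "set xs = decoded (set Y)" "card (set xs) \<le> k"
      using r by (auto simp: decoding_def split: if_splits)
    have "set xs \<subseteq> {1..u}" "length xs \<le> k"
      using xs(2,3) decoded_subset distinct_card[OF xs(1)] by auto
    then have "size (enc_nats xs) \<le> k * (2 * m + 1)" by (rule size_enc_nats_word[OF _ _ m])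
    then show ?thesis using Some by simp
  qed simp
  have "size (Node (enc_option enc_nats r) (enc_state (Y # st) R)) =
      size (enc_option enc_nats r) + size (enc_natss (Y # st)) + size (enc_natss R) +
      size (enc_natss ss) + 3"
    by (simp add: enc_state_def)
  then show ?thesis
    using add_mono[OF add_mono[OF add_mono[OF decoded stack] results] tuples]
    unfolding size_bound_def by linarith
qed

text \<open>The potential drops in every iteration and so bounds their number. The 13 is the loop
  test (3) plus the overhead of the two calls (6 and 4); the leading 3 is the last, failing
  test.\<close>

lemma search_loop_exec:
  assumes P: "\<And>v. \<exists>t s. exec P (init v) t s \<and> s 0 = search_step v \<and> t \<le> (size v + 2) ^ b"
    and m: "u < 2 ^ m"
    and "invariant st R" "s 5 = desc" "s 2 = enc_state st R"
  shows "\<exists>t s'. exec (search_loop D P) s t s' \<and> (\<exists>R'. s' 2 = enc_state [] R' \<and> invariant [] R') \<and>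
    t \<le> 3 + potential st * (nat \<lfloor>T\<rfloor> + (size_bound m + 2) ^ b + 13)"
  using assms(3-)
proof (induction "potential st" arbitrary: st R s rule: less_induct)
  case less
  show ?case
  proof (cases st)
    case Nil
    have "exec (search_loop D P) s (1 + cost (Left (Var 2))) s"
      unfolding search_loop_def using less.prems Nil
      by (intro exec.WhileFalse) (simp add: enc_state_def)
    then show ?thesis by (rule ex_execI) (use less.prems Nil in auto)
  next
    case (Cons Y st0)
    note inv = less.prems(1)[unfolded Cons]
    have Y: "distinct Y" "is_code (set Y)" using inv by (auto simp: invariant_def)
    obtain t1 r where 1: "runs D (Node desc (enc_nats Y)) t1 (enc_option enc_nats r)"
        "real t1 \<le> T" "decoding Y r"
      using decoder_exec[OF Y] .
    then obtain s1 where s1: "exec D (init (Node desc (enc_nats Y))) t1 s1"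
        "s1 0 = enc_option enc_nats r"
      unfolding runs_def by blast
    have t1: "t1 \<le> nat \<lfloor>T\<rfloor>" using 1(2) by (simp add: le_nat_floor)
    let ?v = "Node (enc_option enc_nats r) (enc_state (Y # st0) R)"
    obtain t2 s2 where 2: "exec P (init ?v) t2 s2" "s2 0 = search_step ?v" "t2 \<le> (size ?v + 2) ^ b"
      using P by blast
    have "(size ?v + 2) ^ b \<le> (size_bound m + 2) ^ b"
      using size_state[OF inv 1(3) m] by (intro power_mono) auto
    then have t2: "t2 \<le> (size_bound m + 2) ^ b" using 2(3) by linarith
    obtain st' R' where step: "search_step ?v = enc_state st' R'" "invariant st' R'"
        "potential st' < potential st"
      using search_step_enc[OF inv 1(3)] unfolding Cons by blast
    let ?s = "s(3 := enc_option enc_nats r, 2 := enc_state st' R')"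
    obtain t3 s3 where 3: "exec (search_loop D P) ?s t3 s3"
        "\<exists>R'. s3 2 = enc_state [] R' \<and> invariant [] R'"
        "t3 \<le> 3 + potential st' * (nat \<lfloor>T\<rfloor> + (size_bound m + 2) ^ b + 13)"
      using less.hyps[OF step(3,2), of ?s] less.prems(2) by auto
    have "exec (search_loop D P) s (1 + cost (Left (Var 2)) + ((6 + t1) + (4 + t2)) + t3) s3"
      unfolding search_loop_def
    proof (rule exec.WhileTrue[OF _ _ 3(1)[unfolded search_loop_def]])
      show "val (Left (Var 2)) s \<noteq> Leaf" using less.prems(3) Cons by (simp add: enc_state_def)
      show "exec (Seq (Call 3 D (Pair (Var 5) (Left (Left (Var 2)))))
          (Call 2 P (Pair (Var 3) (Var 2)))) s (6 + t1 + (4 + t2)) ?s"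
      proof (rule exec.Seq)
        show "exec (Call 3 D (Pair (Var 5) (Left (Left (Var 2))))) s (6 + t1)
            (s(3 := enc_option enc_nats r))"
          by (rule exec_Call[where s' = s1])
            (use s1 less.prems Cons in \<open>simp_all add: enc_state_def\<close>)
        show "exec (Call 2 P (Pair (Var 3) (Var 2))) (s(3 := enc_option enc_nats r)) (4 + t2) ?s"
          by (rule exec_Call[where s' = s2]) (use 2 step(1) less.prems Cons in simp_all)
      qed
    qed
    moreover have "1 + cost (Left (Var 2)) + ((6 + t1) + (4 + t2)) + t3 \<le>
        3 + Suc (potential st') * (nat \<lfloor>T\<rfloor> + (size_bound m + 2) ^ b + 13)"
      using 3(3) t1 t2 by simp
    moreover have "Suc (potential st') * (nat \<lfloor>T\<rfloor> + (size_bound m + 2) ^ b + 13) \<le>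
        potential st * (nat \<lfloor>T\<rfloor> + (size_bound m + 2) ^ b + 13)"
      using step(3) by (intro mult_le_mono1) auto
    ultimately show ?thesis using 3(2) by (meson add_le_mono1 add_left_mono le_trans)
  qed
qed

section \<open>Start and end of the search\<close>

lemma invariant_init: "invariant [[]] []"
proof -
  have "is_code {}" unfolding is_code_def code_of_set_def by blast
  moreover have "weight [] \<le> (N + 1) ^ (k + 1)"
    unfolding weight_def by (intro power_increasing) (auto simp: rank_def)
  ultimately show ?thesis by (simp add: invariant_def potential_def)
qed

text \<open>A recorded cover contains a solution, which is recorded too since the stack is empty; in
  an antichain the two must coincide.\<close>

lemma invariant_final:
  assumes "invariant [] R"
  shows "lists_sets R (witness_supersets k u c \<F>)"
proof -
  have sol: "witness_supersets k u c \<F> \<subseteq> set ` set R" and R: "antichain R"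
    "\<forall>X\<in>set R. distinct X \<and> set X \<subseteq> {1..u} \<and> card (set X) \<le> k \<and> covers c \<F> (set X)"
    using assms unfolding invariant_def by auto
  have "set X \<in> witness_supersets k u c \<F>" if X: "X \<in> set R" for X
  proof -
    obtain V where V: "V \<in> witness_supersets k u c \<F>" "V \<subseteq> set X"
      using minimal_solution_below[of "set X"] R(2) X by blast
    then obtain Z where "Z \<in> set R" "V = set Z" using sol by blast
    then show ?thesis using antichain_subset[OF R(1) _ X] V by blast
  qed
  then show ?thesis
    using sol R antichain_distinct[OF R(1)] unfolding lists_sets_def lists_set_def by auto
qed

lemma search_com_runs:
  assumes P: "\<And>v. \<exists>t s. exec P (init v) t s \<and> s 0 = search_step v \<and> t \<le> (size v + 2) ^ b"
    and m: "u < 2 ^ m"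
  shows "\<exists>t R. runs (search_com D P) (Node desc (enc_natss ss)) t (enc_natss R) \<and>
    lists_sets R (witness_supersets k u c \<F>) \<and>
    t \<le> (N + 1) ^ (k + 1) * (nat \<lfloor>T\<rfloor> + (size_bound m + 2) ^ b + 13) + 20"
proof -
  let ?v = "Node desc (enc_natss ss)"
  let ?s = "(init ?v)(5 := desc, 2 := enc_state [[]] [])"
  obtain t s R where 1: "exec (search_loop D P) ?s t s" "s 2 = enc_state [] R" "invariant [] R"
      "t \<le> 3 + potential [[]] * (nat \<lfloor>T\<rfloor> + (size_bound m + 2) ^ b + 13)"
    using search_loop_exec[OF P m invariant_init, of ?s] by auto
  have "potential [[]] \<le> (N + 1) ^ (k + 1)" using invariant_init unfolding invariant_def by simp
  then have "potential [[]] * (nat \<lfloor>T\<rfloor> + (size_bound m + 2) ^ b + 13) \<le>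
      (N + 1) ^ (k + 1) * (nat \<lfloor>T\<rfloor> + (size_bound m + 2) ^ b + 13)"
    by (rule mult_le_mono1)
  then have "3 + (9 + (t + 4)) \<le>
      (N + 1) ^ (k + 1) * (nat \<lfloor>T\<rfloor> + (size_bound m + 2) ^ b + 13) + 20"
    using 1(4) by linarith
  moreover have "exec (search_com D P) (init ?v) (3 + (9 + (t + 4))) (s(0 := enc_natss R))"
    unfolding search_com_def
  proof (intro exec.Seq)
    show "exec (Assign 5 (Left (Var 0))) (init ?v) 3 ((init ?v)(5 := desc))"
      by (rule exec_Assign) auto
    show "exec (Assign 2 (Pair (Pair Empty Empty) (Pair Empty (Right (Var 0)))))
        ((init ?v)(5 := desc)) 9 ?s"
      by (rule exec_Assign) (auto simp: enc_state_def)
    show "exec (search_loop D P) ?s t s" by (rule 1)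
    show "exec (Assign 0 (Left (Right (Var 2)))) s 4 (s(0 := enc_natss R))"
      by (rule exec_Assign) (use 1 in \<open>auto simp: enc_state_def\<close>)
  qed
  then have "runs (search_com D P) ?v (3 + (9 + (t + 4))) (enc_natss R)"
    unfolding runs_def by (intro exI[of _ "s(0 := enc_natss R)"]) simp
  ultimately show ?thesis
    using invariant_final[OF 1(3)] by blast
qed

end


section \<open>The running time\<close>

text \<open>The common shape of the summands of \<open>size_bound\<close>. As \<open>Q\<close> is at
  least 2, numerical factors become powers of \<open>Q\<close>.\<close>

lemma mult_add_one_le_power:
  fixes x y Q :: nat
  assumes "2 \<le> Q" "x \<le> Q" "y \<le> Q"
  shows "x * (2 * y + 1) + 1 \<le> Q ^ 5"
proof -
  have Q2: "4 \<le> Q ^ 2" using power_mono[OF assms(1), of 2] by simp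
  have "2 * y + 1 \<le> 4 * Q" using assms by simp
  also have "\<dots> \<le> Q ^ 2 * Q" using Q2 by (rule mult_le_mono1)
  finally have "x * (2 * y + 1) \<le> Q * (Q ^ 2 * Q)" using assms(2) by (rule mult_le_mono[rotated])
  moreover have "1 \<le> Q * (Q ^ 2 * Q)" using assms(1) by simp
  ultimately have "x * (2 * y + 1) + 1 \<le> 2 * (Q * (Q ^ 2 * Q))" by linarith
  also have "\<dots> \<le> Q * (Q * (Q ^ 2 * Q))" using assms(1) by (rule mult_le_mono1)
  also have "\<dots> = Q ^ 5" by (simp add: power_numeral_reduce power2_eq_square)
  finally show ?thesis .
qed

text \<open>Since E = K k is at least 1, additive constants in exponents become multiples of E. The
  number of iterations is at most Q ^ (6 E), as (K + 2) (k + 1) <= 3 K * 2 k. The size is at most Q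
  ^ (6 E + 8), whence the 14. The 13 is 6 for the iterations, 4 for \<open>t\<close> and the
  overhead, 2 for adding the costs of an iteration, and 1 for the final 20.\<close>

lemma running_time_bound:
  fixes Q :: nat
  assumes Q: "2 \<le> Q" and le: "q \<le> Q" "K \<le> Q" "k \<le> Q" "m \<le> Q" "t \<le> Q" "M \<le> Q ^ K"
    and pos: "1 \<le> K" "1 \<le> k"
  shows "(M * K + 1) ^ (k + 1) *
      (t + ((M * K + 1) ^ (k + 1) * (q * (2 * q + 1) + 1) +
        (M * K + 1) ^ (k + 1) * (k * (2 * m + 1) + 1) +
        M * (K * (2 * q + 1) + 1) + k * (2 * m + 1) + 4 + 2) ^ b + 13) + 20
    \<le> Q ^ ((13 + 14 * b) * (K * k))"
proof -
  define E where "E = K * k"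
  have E: "1 \<le> E" "K \<le> E" using pos by (simp_all add: E_def)
  have Q1: "1 \<le> Q" using Q by simp
  note mono = power_increasing[OF _ Q1]
  have num: "6 \<le> Q ^ 3" "13 \<le> Q ^ 4" "20 \<le> Q ^ 5"
    using power_mono[OF Q, of 3] power_mono[OF Q, of 4] power_mono[OF Q, of 5] by simp_all
  define I where "I = (M * K + 1) ^ (k + 1)"
  have "M * K + 1 \<le> Q ^ K * Q + 1" using le by (simp add: mult_le_mono)
  also have "\<dots> \<le> 2 * (Q ^ K * Q)" using Q1 by simp
  also have "\<dots> \<le> Q * (Q ^ K * Q)" using Q by (rule mult_le_mono1)
  also have "\<dots> = Q ^ (K + 2)" by simp
  finally have "I \<le> (Q ^ (K + 2)) ^ (k + 1)" unfolding I_def by (intro power_mono) auto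
  also have "\<dots> = Q ^ ((K + 2) * (k + 1))" by (rule power_mult[symmetric])
  also have "\<dots> \<le> Q ^ (6 * E)"
  proof (rule mono)
    have "(K + 2) * (k + 1) \<le> (3 * K) * (2 * k)" using pos by (intro mult_le_mono) auto
    then show "(K + 2) * (k + 1) \<le> 6 * E" by (simp add: E_def)
  qed
  finally have I: "I \<le> Q ^ (6 * E)" .
  define B where "B = I * (q * (2 * q + 1) + 1) + I * (k * (2 * m + 1) + 1) +
    M * (K * (2 * q + 1) + 1) + k * (2 * m + 1) + 4 + 2"
  define Z where "Z = Q ^ (6 * E + 5)"
  have 1: "I * (q * (2 * q + 1) + 1) \<le> Z" "I * (k * (2 * m + 1) + 1) \<le> Z"
    unfolding Z_def power_add using mult_add_one_le_power[OF Q] le by (intro mult_le_mono I; simp)+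
  have "M \<le> Q ^ (6 * E)" using le(6) mono[of K "6 * E"] E by simp
  then have 2: "M * (K * (2 * q + 1) + 1) \<le> Z"
    unfolding Z_def power_add using mult_add_one_le_power[OF Q] le by (intro mult_le_mono; simp)
  have 3: "k * (2 * m + 1) + 1 \<le> Z" "6 \<le> Z"
    using mult_add_one_le_power[OF Q, of k m] le mono[of 5 "6 * E + 5"] mono[of 3 "6 * E + 5"] num
    unfolding Z_def by simp_all
  have "B \<le> 5 * Z" unfolding B_def using 1 2 3 by linarith
  also have "\<dots> \<le> Q ^ 3 * Z" using num(1) by (intro mult_le_mono1) simp
  also have "\<dots> = Q ^ (6 * E + 8)" by (simp add: Z_def add.commute flip: power_add)
  also have "\<dots> \<le> Q ^ (14 * E)" using E by (intro mono) simp
  finally have "B ^ b \<le> Q ^ (14 * E * b)" by (metis power_mono power_mult zero_le)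
  define X where "X = Q ^ (14 * E * b + 4 * E)"
  have "t \<le> X" "B ^ b \<le> X" "13 \<le> X"
    using le(5) \<open>B ^ b \<le> _\<close> num(2) mono[of 1 "14 * E * b + 4 * E"] E
      mono[of "14 * E * b" "14 * E * b + 4 * E"] mono[of 4 "14 * E * b + 4 * E"]
    unfolding X_def by simp_all
  then have "t + B ^ b + 13 \<le> 4 * X" by linarith
  also have "\<dots> \<le> Q ^ 2 * X" using power_mono[OF Q, of 2] by (intro mult_le_mono1) simp
  finally have "I * (t + B ^ b + 13) \<le> Q ^ (6 * E) * (Q ^ 2 * X)" by (rule mult_le_mono[OF I])
  moreover have X: "Q ^ (6 * E) * (Q ^ 2 * X) = Q ^ (6 * E + (2 + (14 * E * b + 4 * E)))"
    unfolding X_def by (simp only: power_add)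
  moreover have "20 \<le> Q ^ (6 * E + (2 + (14 * E * b + 4 * E)))"
    by (rule le_trans[OF num(3) mono]) (use E in simp)
  ultimately have "I * (t + B ^ b + 13) + 20 \<le> 2 * (Q ^ (6 * E) * (Q ^ 2 * X))" by linarith
  also have "\<dots> \<le> Q * (Q ^ (6 * E) * (Q ^ 2 * X))" using Q by (rule mult_le_mono1)
  also have "\<dots> = Q ^ (1 + (6 * E + (2 + (14 * E * b + 4 * E))))"
    unfolding X by simp
  also have "\<dots> \<le> Q ^ ((13 + 14 * b) * E)"
    using E by (intro mono) (simp add: algebra_simps)
  finally show ?thesis unfolding I_def B_def E_def .
qed

text \<open>The second variable lets the arguments K log u and k log u be replaced by the common
  base K k log u. Coefficients may be negative, hence the absolute values.\<close>

lemma poly_growth: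
  fixes p :: "real poly"
  obtains A n where "0 \<le> A" "\<And>x y. 1 \<le> x \<Longrightarrow> x \<le> y \<Longrightarrow> \<bar>poly p x\<bar> \<le> A * y ^ n"
proof
  let ?A = "\<Sum>i\<le>degree p. \<bar>coeff p i\<bar>"
  show "0 \<le> ?A" by (intro sum_nonneg) simp
  fix x y :: real assume x: "1 \<le> x" "x \<le> y"
  have "\<bar>poly p x\<bar> \<le> (\<Sum>i\<le>degree p. \<bar>coeff p i * x ^ i\<bar>)"
    unfolding poly_altdef by (rule sum_abs)
  also have "\<dots> \<le> (\<Sum>i\<le>degree p. \<bar>coeff p i\<bar> * y ^ degree p)"
  proof (rule sum_mono)
    fix i assume "i \<in> {..degree p}"
    then have "x ^ i \<le> x ^ degree p" using x by (intro power_increasing) auto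
    also have "\<dots> \<le> y ^ degree p" using x by (intro power_mono) auto
    finally show "\<bar>coeff p i * x ^ i\<bar> \<le> \<bar>coeff p i\<bar> * y ^ degree p"
      using x by (simp add: abs_mult mult_left_mono)
  qed
  also have "\<dots> = ?A * y ^ degree p" by (simp add: sum_distrib_right)
  finally show "\<bar>poly p x\<bar> \<le> ?A * y ^ degree p" .
qed

text \<open>For \<open>u\<close> below 2 no time is claimed, and any \<open>m\<close> with
  \<open>u < 2 ^ m\<close> serves.\<close>

lemma bit_length:
  fixes u :: nat
  obtains m where "u < 2 ^ m" "2 \<le> u \<longrightarrow> real m \<le> log 2 (real u) + 1"
proof (cases "2 \<le> u")
  case True
  then obtain n where n: "2 ^ n \<le> u" "u < 2 ^ (n + 1)"
    using ex_power_ivl1[of 2 u] by auto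
  have "real n \<le> log 2 (real u)"
    using n(1) True by (intro le_log2_of_power)
  then show thesis using that[of "n + 1"] n(2) by simp
next
  case False
  then show thesis using that[of u] less_exp[of u] by blast
qed

text \<open>
  A constant factor \<open>2 ^ (\<alpha> * E)\<close> is absorbed by \<open>B ^ (\<alpha> * E)\<close> as soon as \<open>B \<ge> 2\<close>; otherwise
  \<open>E = 1\<close> and it is a constant.
\<close>

lemma absorb_constant:
  fixes B x :: real and E \<alpha> \<beta> e :: nat
  assumes B: "1 \<le> B" "real E \<le> B" and E: "1 \<le> E" and x: "0 \<le> x" "x \<le> 2 ^ \<alpha> * B ^ e"
  shows "x ^ (\<beta> * E) \<le> 2 ^ (\<alpha> * \<beta>) * B ^ ((\<alpha> * \<beta> + e * \<beta>) * E)"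
proof -
  have "(2 :: real) ^ (\<alpha> * \<beta> * E) \<le> 2 ^ (\<alpha> * \<beta>) * B ^ (\<alpha> * \<beta> * E)"
  proof (cases "E = 1")
    case True
    then show ?thesis using one_le_power[OF B(1), of "\<alpha> * \<beta>"] by simp
  next
    case False
    then have "2 \<le> B" using E B(2) by simp
    then have "(2 :: real) ^ (\<alpha> * \<beta> * E) \<le> B ^ (\<alpha> * \<beta> * E)" by (intro power_mono) auto
    moreover have "1 * B ^ (\<alpha> * \<beta> * E) \<le> 2 ^ (\<alpha> * \<beta>) * B ^ (\<alpha> * \<beta> * E)"
      using B(1) by (intro mult_right_mono) auto
    ultimately show ?thesis by simp
  qed
  then have "2 ^ (\<alpha> * \<beta> * E) * B ^ (e * \<beta> * E) \<le>
      2 ^ (\<alpha> * \<beta>) * B ^ (\<alpha> * \<beta> * E) * B ^ (e * \<beta> * E)"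
    using B(1) by (intro mult_right_mono) auto
  moreover have "x ^ (\<beta> * E) \<le> (2 ^ \<alpha> * B ^ e) ^ (\<beta> * E)" using x by (intro power_mono)
  ultimately show ?thesis
    by (simp add: power_mult_distrib power_mult power_add add_mult_distrib mult.assoc)
qed

theorem theorem24:
  fixes D :: com and pq pd :: "real poly"
  shows "\<exists>(M :: com) (a :: real) (b :: nat).
    \<forall>(desc :: tree) (K :: nat) (k :: nat) (u :: nat) (q :: nat) (C :: nat \<Rightarrow> nat set)
      (c :: nat) (\<F> :: nat \<Rightarrow> nat set set) (L :: nat \<Rightarrow> nat set list) (S :: nat list set)
      (ss :: nat list list).
      binary_code u q C \<and> superimposed k u C \<and>
      real q \<le> poly pq (real K * log 2 (real u)) \<and>
      decodes D desc k u q C (poly pd (real k * log 2 (real u))) \<and>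
      witness_instance K k u c \<F> \<and>
      (\<forall>i\<in>{1..c}. listing K (\<F> i) (L i)) \<and>
      S = (\<Union>i\<in>{1..c}. code_tensor C (L i)) \<and> lists_set ss S \<longrightarrow>
      (\<exists>(t :: nat) (Ws :: nat list list).
        runs M (Node desc (enc_list (enc_list enc_nat) ss)) t (enc_list (enc_list enc_nat) Ws) \<and>
        lists_sets Ws (witness_supersets k u c \<F>) \<and>
        (1 \<le> K \<and> 1 \<le> k \<and> 2 \<le> u \<longrightarrow>
          real t \<le> a * (real K * real k * log 2 (real u)) ^ (b * K * k)))"
proof -
  obtain P h where h: "poly_bounded h"
    and P: "\<And>v. \<exists>t s. exec P (init v) t s \<and> s 0 = search_step v \<and> t \<le> h v"
    by (rule ptimeE[OF ptime_search_step]) (rule that)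
  obtain b where b: "\<And>v. h v \<le> (size v + 2) ^ b" using h unfolding poly_bounded_def by blast
  have P': "\<exists>t s. exec P (init v) t s \<and> s 0 = search_step v \<and> t \<le> (size v + 2) ^ b" for v
    using P[of v] b[of v] by (meson le_trans)
  obtain A1 e1 where A1: "0 \<le> A1" "\<And>x y. 1 \<le> x \<Longrightarrow> x \<le> y \<Longrightarrow> \<bar>poly pq x\<bar> \<le> A1 * y ^ e1"
    by (rule poly_growth[of pq]) (rule that)
  obtain A2 e2 where A2: "0 \<le> A2" "\<And>x y. 1 \<le> x \<Longrightarrow> x \<le> y \<Longrightarrow> \<bar>poly pd x\<bar> \<le> A2 * y ^ e2"
    by (rule poly_growth[of pd]) (rule that)
  \<comment> \<open>In the estimate of \<open>Q\<close> below, \<open>q\<close> contributes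
    \<open>A1\<close>, the decoding time \<open>A2\<close>, and the 6 stands for \<open>K\<close>,
    \<open>k\<close>, \<open>m\<close> (counted twice because of the rounding in
    \<open>bit_length\<close>) and the constant 2.\<close>
  obtain \<alpha> :: nat where \<alpha>: "A1 + A2 + 6 \<le> 2 ^ \<alpha>"
    using real_arch_pow[of 2 "A1 + A2 + 6"] by (auto intro: less_imp_le)
  \<comment> \<open>The summand 1 ensures that \<open>B\<close> itself is at most
    \<open>B ^ e\<close>, even if both polynomials are constant.\<close>
  define e where "e = e1 + e2 + 1"
  define \<beta> where "\<beta> = 13 + 14 * b"
  show ?thesis
  proof (rule exI[of _ "search_com D P"], rule exI[of _ "2 ^ (\<alpha> * \<beta>)"],
      rule exI[of _ "\<alpha> * \<beta> + e * \<beta>"], intro allI impI, elim conjE)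
    fix desc K k u q C c \<F> L S ss
    assume "binary_code u q C" "superimposed k u C"
      and q: "real q \<le> poly pq (real K * log 2 (real u))"
      and "decodes D desc k u q C (poly pd (real k * log 2 (real u)))"
      and "witness_instance K k u c \<F>" "\<forall>i\<in>{1..c}. listing K (\<F> i) (L i)"
      and "S = (\<Union>i\<in>{1..c}. code_tensor C (L i))" "lists_set ss S"
    then interpret search_instance K k u q c C \<F> L S D desc "poly pd (real k * log 2 (real u))" ss
      by unfold_locales
    define T where "T = nat \<lfloor>poly pd (real k * log 2 (real u))\<rfloor>"
    obtain m where m: "u < 2 ^ m" "2 \<le> u \<longrightarrow> real m \<le> log 2 (real u) + 1" by (rule bit_length)
    obtain t R where R: "runs (search_com D P) (Node desc (enc_natss ss)) t (enc_natss R)"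
        "lists_sets R (witness_supersets k u c \<F>)"
        "t \<le> (N + 1) ^ (k + 1) * (T + (size_bound m + 2) ^ b + 13) + 20"
      using search_com_runs[OF P' m(1)] unfolding T_def by blast
    have "real t \<le> 2 ^ (\<alpha> * \<beta>) * (real K * real k * log 2 (real u)) ^ ((\<alpha> * \<beta> + e * \<beta>) * K * k)"
      if pos: "1 \<le> K" "1 \<le> k" "2 \<le> u"
    proof -
      define l where "l = log 2 (real u)"
      define B where "B = real K * real k * l"
      \<comment> \<open>One number dominating all parameters; the 2 makes it a legitimate base for
        \<open>running_time_bound\<close>.\<close>
      define Q where "Q = q + K + k + m + T + 2"
      have l: "1 \<le> l" using pos(3) by (simp add: l_def le_log_iff)
      have Kk: "real K * 1 \<le> real K * real k" "1 * real k \<le> real K * real k"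
        using pos by (intro mult_left_mono mult_right_mono; simp)+
      \<comment> \<open>\<open>absorb_constant\<close> requires the base to dominate the exponent K
        k, which holds because log u is at least 1.\<close>
      have BE: "real (K * k) \<le> B"
        using l mult_left_mono[OF l, of "real K * real k"] by (simp add: B_def)
      have Bk: "real K * l \<le> B" "real k * l \<le> B"
        using mult_right_mono[OF Kk(1), of l] mult_right_mono[OF Kk(2), of l] l
        by (simp_all add: B_def)
      have ge: "1 \<le> real K * l" "1 \<le> real k * l"
        using mult_mono[of 1 "real K" 1 l] mult_mono[of 1 "real k" 1 l] pos l by auto
      have B: "1 \<le> B" "real K \<le> B" "real k \<le> B" "l \<le> B"
        using order_trans[OF ge(1) Bk(1)] order_trans[OF Kk(1), of B] order_trans[OF Kk(2), of B] BE
          order_trans[OF mult_right_mono[of 1 "real K" l] , of B] Bk(1) pos(1) l by simp_all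
      have pow: "B ^ e1 \<le> B ^ e" "B ^ e2 \<le> B ^ e" "B \<le> B ^ e"
        using power_increasing[OF _ B(1), of e1 e] power_increasing[OF _ B(1), of e2 e]
          power_increasing[OF _ B(1), of 1 e] by (simp_all add: e_def)
      have "real q \<le> A1 * B ^ e"
        using q A1(2)[OF ge(1) Bk(1)] mult_left_mono[OF pow(1) A1(1)] unfolding l_def by linarith
      moreover have "real T \<le> A2 * B ^ e"
        using A2(2)[OF ge(2) Bk(2)] mult_left_mono[OF pow(2) A2(1)] unfolding T_def l_def by linarith
      moreover have "real m \<le> B ^ e + 1" using m(2) pos(3) B(4) pow(3) unfolding l_def by simp
      moreover have "1 \<le> B ^ e" using B(1) by (rule one_le_power)
      ultimately have "real Q \<le> A1 * B ^ e + A2 * B ^ e + 6 * B ^ e"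
        using B(2,3) pow(3) unfolding Q_def by simp
      also have "\<dots> = (A1 + A2 + 6) * B ^ e" by (simp add: algebra_simps)
      also have "\<dots> \<le> 2 ^ \<alpha> * B ^ e" using \<alpha> B(1) by (intro mult_right_mono) auto
      finally have Q: "real Q \<le> 2 ^ \<alpha> * B ^ e" .
      have "card S \<le> Q ^ K"
        using card_S power_mono[of q Q K] by (simp add: Q_def)
      then have "t \<le> Q ^ (\<beta> * (K * k))"
        using running_time_bound[of Q q K k m T "card S" b] R(3) pos
        unfolding Q_def \<beta>_def size_bound_def N_def by simp
      then have "real t \<le> real Q ^ (\<beta> * (K * k))" by (metis of_nat_le_iff of_nat_power)
      also have "\<dots> \<le> 2 ^ (\<alpha> * \<beta>) * B ^ ((\<alpha> * \<beta> + e * \<beta>) * (K * k))"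
        using pos by (intro absorb_constant[OF B(1) BE _ _ Q]) auto
      finally show ?thesis unfolding B_def l_def by (simp add: mult.assoc)
    qed
    then show "\<exists>t Ws. runs (search_com D P) (Node desc (enc_natss ss)) t (enc_natss Ws) \<and>
        lists_sets Ws (witness_supersets k u c \<F>) \<and>
        (1 \<le> K \<and> 1 \<le> k \<and> 2 \<le> u \<longrightarrow> real t \<le> 2 ^ (\<alpha> * \<beta>) *
          (real K * real k * log 2 (real u)) ^ ((\<alpha> * \<beta> + e * \<beta>) * K * k))"
      using R(1,2) by blast
  qed
qed

end
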